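(* Every class of finite graphs with bounded Baker-treewidth has asymptotic dimension at most $2$.
   Context: A layering of $G$ is an ordered partition $(L_0,L_1,\dots)$ of $V(G)$ such that every edge has its ends in the same or consecutive parts. A class $\mathcal{G}$ has bounded Baker-treewidth if there is $f\colon\mathbb{N}\to\mathbb{N}$ such that every $G\in\mathcal{G}$ has a layering in which the subgraph induced by the union of any $\ell$ consecutive layers has treewidth at most $f(\ell)$. With $\mathrm{dist}_G$ the shortest-path metric: the weak-diameter of $X\subseteq V(G)$ is $\max\{\mathrm{dist}_G(u,v)\colon u,v\in X\}$; a collection $\mathcal{U}$ of vertex sets is $\delta$-disjoint if $\mathrm{dist}_G(X,Y)>\delta$ for all distinct $X,Y\in\mathcal{U}$, and $(k,\delta)$-disjoint if it is a union of $k$ $\delta$-disjoint subcollections. $f\colon\mathbb{R}^+\to\mathbb{R}^+$ is a $d$-dimensional control function for $G$ if for every $\delta\ge 0$ there is a $(d+1,\delta)$-disjoint partition of $V(G)$ into sets of weak-diameter at most $f(\delta)$. The asymptotic dimension of a class is the minimum $d$ for which a single $d$-dimensional control function works for all graphs in the class (infinite if none exists). *)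

theory Defs
  imports
    "Graph_Theory.Digraph_Component"
    "Graph_Theory.Shortest_Path"
    "HOL-Library.Disjoint_Sets"
    "HOL-Library.Extended_Nat"
begin

text \<open>
  Finite simple graphs are the symmetric digraphs of the locale \<^locale>\<open>graph\<close>; an undirected
  edge is a pair of opposite arcs.
\<close>

section \<open>Treewidth\<close>

text \<open>
  The constant \<^const>\<open>tree\<close> is not usable here: in a symmetric digraph, every pair of opposite
  arcs is a directed cycle. Undirected cycles are the directed cycles of length at least 3.
\<close>

definition undirected_tree :: "('t, 'e) pre_digraph \<Rightarrow> bool" where
  "undirected_tree T \<longleftrightarrow>
     graph T \<and> Digraph_Component.connected T \<and> \<not> (\<exists>p. pre_digraph.cycle T p \<and> 3 \<le> length p)"

text \<open>
  Connected digraphs are nonempty by definition, so the last condition also says that every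
  vertex lies in some bag.
\<close>

definition tree_decomposition ::
  "('a, 'b) pre_digraph \<Rightarrow> ('t, 'e) pre_digraph \<Rightarrow> ('t \<Rightarrow> 'a set) \<Rightarrow> bool" where
  "tree_decomposition G T B \<longleftrightarrow>
     undirected_tree T \<and>
     (\<forall>t\<in>verts T. B t \<subseteq> verts G) \<and>
     (\<forall>e\<in>arcs G. \<exists>t\<in>verts T. tail G e \<in> B t \<and> head G e \<in> B t) \<and>
     (\<forall>v\<in>verts G. Digraph_Component.connected (induce_subgraph T {t \<in> verts T. v \<in> B t}))"

text \<open>
  Natural-number subtraction: the empty graph gets treewidth 0 rather than \<open>-1\<close>.
\<close>

definition decomposition_width :: "('t, 'e) pre_digraph \<Rightarrow> ('t \<Rightarrow> 'a set) \<Rightarrow> nat" where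
  "decomposition_width T B = Max ((\<lambda>t. card (B t)) ` verts T) - 1"

text \<open>
  Decomposition trees are finite, hence no generality is lost by taking their nodes in \<^typ>\<open>nat\<close>.
  Meaningful for finite graphs only, where all bags are finite.
\<close>

definition treewidth :: "('a, 'b) pre_digraph \<Rightarrow> enat" where
  "treewidth G = Inf {enat (decomposition_width T B) | (T :: (nat, nat \<times> nat) pre_digraph) B.
     tree_decomposition G T B}"


section \<open>Layerings and Baker-treewidth\<close>

text \<open>
  Layers may be empty; as they are indexed by all natural numbers, almost all layers of a finite
  graph are.
\<close>

definition layering :: "('a, 'b) pre_digraph \<Rightarrow> (nat \<Rightarrow> 'a set) \<Rightarrow> bool" where
  "layering G L \<longleftrightarrow>
     disjoint_family L \<and> (\<Union>i. L i) = verts G \<and>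
     (\<forall>e\<in>arcs G. \<forall>i j. tail G e \<in> L i \<longrightarrow> head G e \<in> L j \<longrightarrow> i \<le> Suc j \<and> j \<le> Suc i)"

definition bounded_Baker_treewidth :: "('a, 'b) pre_digraph set \<Rightarrow> bool" where
  "bounded_Baker_treewidth \<G> \<longleftrightarrow>
     (\<exists>f :: nat \<Rightarrow> nat. \<forall>G\<in>\<G>. \<exists>L. layering G L \<and>
        (\<forall>l i. treewidth (induce_subgraph G (\<Union>j\<in>{i..<i + l}. L j)) \<le> enat (f l)))"


section \<open>Asymptotic dimension\<close>

text \<open>
  The distance between vertices of different components is \<open>\<infinity>\<close>.
\<close>

definition graph_dist :: "('a, 'b) pre_digraph \<Rightarrow> 'a \<Rightarrow> 'a \<Rightarrow> ereal" where
  "graph_dist G u v = wf_digraph.\<mu> G (\<lambda>_. 1) u v"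

definition set_dist :: "('a, 'b) pre_digraph \<Rightarrow> 'a set \<Rightarrow> 'a set \<Rightarrow> ereal" where
  "set_dist G X Y = (INF x\<in>X. INF y\<in>Y. graph_dist G x y)"

definition weak_diameter :: "('a, 'b) pre_digraph \<Rightarrow> 'a set \<Rightarrow> ereal" where
  "weak_diameter G X = (SUP u\<in>X. SUP v\<in>X. graph_dist G u v)"

definition delta_disjoint :: "('a, 'b) pre_digraph \<Rightarrow> real \<Rightarrow> 'a set set \<Rightarrow> bool" where
  "delta_disjoint G \<delta> \<U> \<longleftrightarrow> (\<forall>X\<in>\<U>. \<forall>Y\<in>\<U>. X \<noteq> Y \<longrightarrow> set_dist G X Y > ereal \<delta>)"

definition k_delta_disjoint :: "('a, 'b) pre_digraph \<Rightarrow> nat \<Rightarrow> real \<Rightarrow> 'a set set \<Rightarrow> bool" where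
  "k_delta_disjoint G k \<delta> \<U> \<longleftrightarrow>
     (\<exists>\<C> :: nat \<Rightarrow> 'a set set. \<U> = (\<Union>i<k. \<C> i) \<and> (\<forall>i<k. delta_disjoint G \<delta> (\<C> i)))"

text \<open>
  Functions on the nonnegative reals are represented by functions on all reals whose values at
  negative arguments are ignored.
\<close>

definition control_function :: "nat \<Rightarrow> (real \<Rightarrow> real) \<Rightarrow> ('a, 'b) pre_digraph \<Rightarrow> bool" where
  "control_function d f G \<longleftrightarrow>
     (\<forall>\<delta>\<ge>0. f \<delta> \<ge> 0) \<and>
     (\<forall>\<delta>\<ge>0. \<exists>\<P>. partition_on (verts G) \<P> \<and> k_delta_disjoint G (d + 1) \<delta> \<P> \<and>
        (\<forall>X\<in>\<P>. weak_diameter G X \<le> ereal (f \<delta>)))"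

text \<open>
  The infimum of the empty set of extended naturals is \<open>\<infinity>\<close>; that of a nonempty set is its minimum.
\<close>

definition asymptotic_dimension :: "('a, 'b) pre_digraph set \<Rightarrow> enat" where
  "asymptotic_dimension \<G> = Inf {enat d | d. \<exists>f. \<forall>G\<in>\<G>. control_function d f G}"

end

theory Submission
  imports Defs
begin

text \<open>
  A colouring of the vertices controls weak diameter at scale \<open>r\<close> if all monochromatic chains of
  steps of length at most \<open>r\<close> have endpoints at bounded distance.

  Graphs of treewidth at most \<open>w\<close> have such colourings with two colours, by induction on \<open>w\<close>.
  The decomposition tree is cut into regions: going down, a new region starts where the bag no
  longer meets the \<open>4 * r\<close>-neighbourhood of the boundary (at most \<open>w\<close> vertices) of the current
  region. Outside these neighbourhoods all bags have lost a vertex, so the induction hypothesis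
  applies there, at a much larger scale. Around the boundary of each region, one annulus in either
  colour isolates the region from its parent; the annuli have bounded chains, and merging them with
  the rest is harmless because of the larger scale.

  For a layering, wide and narrow bands of layers alternate, the former coloured at scale \<open>r\<close> and the
  latter at a larger scale. In every wide band, a third colour replaces the first colour on one group
  of \<open>r\<close> layers and the second colour on another, so that no chain crosses the band.
\<close>

section \<open>Chains of short steps\<close>

text \<open>Distance at most \<open>n\<close> in \<open>E\<close>. The reflexive closure lets walks
  idle, so the relation grows with \<open>n\<close>, and it contains \<open>Id\<close> even outside
  the vertex set.\<close>

definition near :: "'a rel \<Rightarrow> nat \<Rightarrow> 'a rel" where
  "near E n = (E\<^sup>=) ^^ n"

text \<open>Only the stops of a chain lie in \<open>S\<close>; the steps are measured in all of
  \<open>E\<close>, as weak diameter requires.\<close>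

definition chain :: "'a rel \<Rightarrow> nat \<Rightarrow> 'a set \<Rightarrow> 'a rel" where
  "chain E r S = (near E r \<inter> S \<times> S)\<^sup>*"

text \<open>The components of \<open>S\<close> at scale \<open>r\<close> have weak diameter at most \<open>D\<close> in the graph \<open>E\<close>.\<close>

definition bounded_chains :: "'a rel \<Rightarrow> nat \<Rightarrow> 'a set \<Rightarrow> nat \<Rightarrow> bool" where
  "bounded_chains E r S D \<longleftrightarrow> chain E r S \<subseteq> near E D"

definition nbhd :: "'a rel \<Rightarrow> nat \<Rightarrow> 'a set \<Rightarrow> 'a set" where
  "nbhd E n X = {v. \<exists>x\<in>X. (v, x) \<in> near E n}"

lemma near_0 [simp]: "near E 0 = Id"
  by (simp add: near_def)

lemma near_refl [simp]: "(x, x) \<in> near E n"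
  unfolding near_def by (induction n) auto

lemma near_add: "near E (m + n) = near E m O near E n"
  unfolding near_def by (rule relpow_add)

lemma near_Suc: "near E (Suc n) = E\<^sup>= O near E n"
  using near_add[of E 1 n] by (simp add: near_def)

lemma near_trans: "(x, y) \<in> near E m \<Longrightarrow> (y, z) \<in> near E n \<Longrightarrow> (x, z) \<in> near E (m + n)"
  by (auto simp: near_add)

lemma near_mono: "m \<le> n \<Longrightarrow> (x, y) \<in> near E m \<Longrightarrow> (x, y) \<in> near E n"
  by (metis le_add_diff_inverse near_refl near_trans)

lemma near_trans_le:
  "(x, y) \<in> near E m \<Longrightarrow> (y, z) \<in> near E n \<Longrightarrow> m + n \<le> k \<Longrightarrow> (x, z) \<in> near E k"
  by (metis near_mono near_trans)

lemma near_edge: "(x, y) \<in> E \<Longrightarrow> (x, y) \<in> near E (Suc 0)"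
  by (simp add: near_def)

lemma near_sym: "sym E \<Longrightarrow> (x, y) \<in> near E n \<Longrightarrow> (y, x) \<in> near E n"
proof (induction n arbitrary: x)
  case (Suc n)
  then obtain z where z: "(x, z) \<in> E\<^sup>=" "(z, y) \<in> near E n"
    by (auto simp: near_Suc)
  then have "(z, x) \<in> near E 1"
    using Suc.prems(1) by (auto simp: near_def dest: symD)
  with Suc z show ?case
    using near_trans[of y z E n x 1] by simp
qed auto

lemma near_subset_power:
  assumes "F \<subseteq> near E M"
  shows "(x, y) \<in> near F n \<Longrightarrow> (x, y) \<in> near E (n * M)"
proof (induction n arbitrary: x)
  case (Suc n)
  then obtain z where z: "(x, z) \<in> F\<^sup>=" "(z, y) \<in> near F n"
    by (auto simp: near_Suc)
  then have "(x, z) \<in> near E M"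
    using assms by auto
  with Suc.IH[OF z(2)] show ?case
    using near_trans by fastforce
qed simp

lemma near_subset: "F \<subseteq> E \<Longrightarrow> (x, y) \<in> near F n \<Longrightarrow> (x, y) \<in> near E n"
  by (induction n arbitrary: x) (auto simp: near_Suc)

section \<open>Short walks that cross or meet a vertex set\<close>

text \<open>The first vertex outside \<open>S\<close> serves as \<open>z\<close>. Recording the
  split of \<open>n\<close> keeps the remaining length available for a second application.\<close>

lemma near_exit:
  assumes exit: "\<And>a b. (a, b) \<in> E \<Longrightarrow> a \<in> S \<Longrightarrow> b \<notin> S \<Longrightarrow> b \<in> Q"
    and "(x, y) \<in> near E n" "x \<in> S" "y \<notin> S"
  obtains z i where "z \<in> Q" "i \<le> n" "(x, z) \<in> near E i" "(z, y) \<in> near E (n - i)"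
proof -
  have "\<exists>z\<in>Q. \<exists>i\<le>n. (x, z) \<in> near E i \<and> (z, y) \<in> near E (n - i)"
    using assms(2,3)
  proof (induction n arbitrary: x)
    case 0
    then show ?case using assms(4) by auto
  next
    case (Suc n)
    then obtain z where z: "(x, z) \<in> E\<^sup>=" "(z, y) \<in> near E n"
      by (auto simp: near_Suc)
    then have xz: "(x, z) \<in> near E 1"
      by (auto simp: near_edge)
    show ?case
    proof (cases "z \<in> S")
      case True
      with Suc.IH z obtain q i where q: "q \<in> Q" "i \<le> n" "(z, q) \<in> near E i" "(q, y) \<in> near E (n - i)"
        by blast
      have "(x, q) \<in> near E (Suc i)"
        using near_trans[OF xz q(3)] by simp
      with q show ?thesis
        by (intro bexI[of _ q] exI[of _ "Suc i"]) auto
    next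
      case False
      with z Suc.prems exit have "z \<in> Q"
        by auto
      with xz z(2) show ?thesis
        by (intro bexI[of _ z] exI[of _ 1]) auto
    qed
  qed
  then show ?thesis using that by blast
qed

lemma near_avoid:
  assumes "(x, y) \<in> near E n"
  shows "(x, y) \<in> near (E - N \<times> UNIV - UNIV \<times> N) n \<or>
    (\<exists>z\<in>N. \<exists>i\<le>n. (x, z) \<in> near E i \<and> (z, y) \<in> near E (n - i))"
  using assms
proof (induction n arbitrary: x)
  case (Suc n)
  let ?F = "E - N \<times> UNIV - UNIV \<times> N"
  obtain z where z: "(x, z) \<in> E\<^sup>=" "(z, y) \<in> near E n"
    using Suc.prems by (auto simp: near_Suc)
  then have xz: "(x, z) \<in> near E 1"
    by (auto simp: near_edge)
  consider "(z, y) \<in> near ?F n" | q i where "q \<in> N" "i \<le> n" "(z, q) \<in> near E i" "(q, y) \<in> near E (n - i)"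
    using Suc.IH[OF z(2)] by blast
  then show ?case
  proof cases
    case 1
    show ?thesis
    proof (cases "(x, z) \<in> ?F\<^sup>=")
      case True
      then show ?thesis using 1 by (auto simp: near_Suc)
    next
      case False
      then have "x \<in> N \<or> z \<in> N" using z by auto
      then show ?thesis
      proof
        assume "x \<in> N"
        then show ?thesis using Suc.prems by (intro disjI2 bexI[of _ x] exI[of _ 0]) auto
      next
        assume "z \<in> N"
        then show ?thesis using z xz by (intro disjI2 bexI[of _ z] exI[of _ 1]) auto
      qed
    qed
  next
    case 2
    then have "(x, q) \<in> near E (Suc i)"
      using near_trans[OF xz 2(3)] by simp
    with 2 show ?thesis
      by (intro disjI2 bexI[of _ q] exI[of _ "Suc i"]) auto
  qed
qed simp

lemma nbhd_mono: "m \<le> n \<Longrightarrow> v \<in> nbhd E m X \<Longrightarrow> v \<in> nbhd E n X"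
  unfolding nbhd_def by (auto intro: near_mono)

lemma nbhd_near:
  "(v, u) \<in> near E m \<Longrightarrow> u \<in> nbhd E n X \<Longrightarrow> m + n \<le> k \<Longrightarrow> v \<in> nbhd E k X"
  unfolding nbhd_def by (blast intro: near_trans_le)

lemma subset_nbhd: "x \<in> X \<Longrightarrow> x \<in> nbhd E n X"
  unfolding nbhd_def by (auto intro: bexI[of _ x])

lemma sym_chain: "sym E \<Longrightarrow> sym (chain E r S)"
  unfolding chain_def by (intro sym_rtrancl symI) (auto intro: near_sym)

lemma chain_step: "(x, y) \<in> near E r \<Longrightarrow> x \<in> S \<Longrightarrow> y \<in> S \<Longrightarrow> (x, y) \<in> chain E r S"
  unfolding chain_def by auto

lemma chain_trans: "(x, y) \<in> chain E r S \<Longrightarrow> (y, z) \<in> chain E r S \<Longrightarrow> (x, z) \<in> chain E r S"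
  unfolding chain_def by auto

lemma chain_refl [simp]: "(x, x) \<in> chain E r S"
  unfolding chain_def by auto

lemma chain_mono: "r \<le> s \<Longrightarrow> S \<subseteq> T \<Longrightarrow> chain E r S \<subseteq> chain E s T"
  unfolding chain_def by (intro rtrancl_mono) (auto intro: near_mono)

lemma chain_induct [consumes 1, case_names refl step]:
  assumes "(x, y) \<in> chain E r S" "P x"
    "\<And>y z. (x, y) \<in> chain E r S \<Longrightarrow> P y \<Longrightarrow> (y, z) \<in> near E r \<Longrightarrow> y \<in> S \<Longrightarrow> z \<in> S \<Longrightarrow> P z"
  shows "P y"
  using assms(1) unfolding chain_def
  by (induction rule: rtrancl_induct) (use assms(2,3) in \<open>auto simp: chain_def\<close>)

lemma chain_endpoints: "(x, y) \<in> chain E r S \<Longrightarrow> x = y \<or> x \<in> S \<and> y \<in> S"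
  by (induction rule: chain_induct) auto

lemma bounded_chainsI:
  assumes "\<And>x y. x \<in> S \<Longrightarrow> y \<in> S \<Longrightarrow> (x, y) \<in> chain E r S \<Longrightarrow> (x, y) \<in> near E D"
  shows "bounded_chains E r S D"
  unfolding bounded_chains_def
proof (rule subrelI)
  fix x y assume xy: "(x, y) \<in> chain E r S"
  show "(x, y) \<in> near E D"
    using chain_endpoints[OF xy] assms[OF _ _ xy] by (cases "x = y") auto
qed

lemma bounded_chainsD: "bounded_chains E r S D \<Longrightarrow> (x, y) \<in> chain E r S \<Longrightarrow> (x, y) \<in> near E D"
  unfolding bounded_chains_def by auto

lemma bounded_chains_mono:
  "bounded_chains E s T D \<Longrightarrow> r \<le> s \<Longrightarrow> S \<subseteq> T \<Longrightarrow> D \<le> D' \<Longrightarrow> bounded_chains E r S D'"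
  using chain_mono[of r s S T E] by (auto simp: bounded_chains_def intro: near_mono[of D D'])

section \<open>Bounding, merging and moving chains\<close>

text \<open>No step changes \<open>h\<close>, so a chain stays in the fibre where it starts.\<close>

lemma bounded_chains_fibres:
  assumes inv: "\<And>x y. x \<in> S \<Longrightarrow> y \<in> S \<Longrightarrow> (x, y) \<in> near E r \<Longrightarrow> h x = h y"
    and bd: "\<And>a. bounded_chains E r {x \<in> S. h x = a} D"
  shows "bounded_chains E r S D"
proof (rule bounded_chainsI)
  fix x y assume "x \<in> S" "(x, y) \<in> chain E r S"
  from this(2) this(1) have "h y = h x \<and> (x, y) \<in> chain E r {z \<in> S. h z = h x}"
  proof (induction rule: chain_induct)
    case (step y z)
    then have "h z = h x" using inv[of y z] by auto
    with step chain_step[of y z E r "{z \<in> S. h z = h x}"] show ?case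
      by (auto intro: chain_trans)
  qed simp
  then show "(x, y) \<in> near E D"
    using bd bounded_chainsD by fast
qed

text \<open>An excursion from \<open>B\<close> into \<open>A\<close> and back covers at most
  \<open>r + DA + r\<close>, which is a single step at the scale for which \<open>B\<close> is
  bounded. So a chain from \<open>B\<close> reduces to a chain in \<open>B\<close> followed by at
  most one unfinished excursion. Any other chain that meets \<open>B\<close> is cut there into two
  such chains, whence the factor 2.\<close>

lemma bounded_chains_union:
  assumes "sym E" and A: "bounded_chains E r A DA" and B: "bounded_chains E (DA + 2 * r) B DB"
  shows "bounded_chains E r (A \<union> B) (2 * (DB + r + DA))"
proof (rule bounded_chainsI)
  let ?R = "DA + 2 * r"
  have from_B: "(x, y) \<in> chain E ?R B \<and> y \<in> B \<or>
    (\<exists>b a. b \<in> B \<and> a \<in> A \<and> y \<in> A \<and> (x, b) \<in> chain E ?R B \<and> (b, a) \<in> near E r \<and> (a, y) \<in> chain E r A)"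
    if "(x, y) \<in> chain E r (A \<union> B)" "x \<in> B" for x y
    using that
  proof (induction rule: chain_induct)
    case (step y z)
    from step.IH[OF step.prems] show ?case
    proof (elim disjE exE conjE)
      assume y: "(x, y) \<in> chain E ?R B" "y \<in> B"
      show ?thesis
      proof (cases "z \<in> B")
        case True
        have "(y, z) \<in> chain E ?R B"
          using y True step.hyps near_mono[of r ?R y z E] by (intro chain_step) auto
        then show ?thesis using y True chain_trans[of x y E ?R B z] by blast
      next
        case False
        then have "z \<in> A" using step by auto
        then show ?thesis using y step.hyps(2)
          by (intro disjI2 exI[of _ y] exI[of _ z]) auto
      qed
    next
      fix b a assume y: "b \<in> B" "a \<in> A" "y \<in> A" "(x, b) \<in> chain E ?R B" "(b, a) \<in> near E r" "(a, y) \<in> chain E r A"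
      show ?thesis
      proof (cases "z \<in> A")
        case True
        then have "(a, z) \<in> chain E r A"
          using y step chain_step[of y z E r A] chain_trans by metis
        then show ?thesis using y True by blast
      next
        case False
        then have zB: "z \<in> B" using step by auto
        have "(a, z) \<in> near E (DA + r)"
          using bounded_chainsD[OF A y(6)] step near_trans by metis
        then have "(b, z) \<in> near E ?R"
          using y(5) near_trans_le[of b a E r z "DA + r" ?R] by auto
        then have "(b, z) \<in> chain E ?R B"
          using y zB by (intro chain_step)
        then show ?thesis using y zB chain_trans by metis
      qed
    qed
  qed simp
  have near_B: "(x, y) \<in> near E (DB + r + DA)"
    if "(x, y) \<in> chain E r (A \<union> B)" "x \<in> B" for x y
    using from_B[OF that]
  proof (elim disjE exE conjE)
    assume "(x, y) \<in> chain E ?R B"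
    from near_mono[OF _ bounded_chainsD[OF B this]] show ?thesis by simp
  next
    fix b a assume y: "(x, b) \<in> chain E ?R B" "(b, a) \<in> near E r" "(a, y) \<in> chain E r A"
    show ?thesis
      using near_trans[OF near_trans[OF bounded_chainsD[OF B y(1)] y(2)] bounded_chainsD[OF A y(3)]] .
  qed
  fix x y assume "x \<in> A \<union> B" "(x, y) \<in> chain E r (A \<union> B)"
  then have "(x, y) \<in> chain E r A \<or>
    (\<exists>b\<in>B. (x, b) \<in> chain E r (A \<union> B) \<and> (b, y) \<in> chain E r (A \<union> B))"
    apply (cases "x \<in> B")
     apply force
    subgoal premises p
      using p(2) p(1,3)
    proof (induction rule: chain_induct)
      case (step y z)
      show ?case
      proof (cases "y \<in> B \<or> z \<in> B")
        case True
        moreover have "(y, z) \<in> chain E r (A \<union> B)"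
          using step by (intro chain_step) auto
        ultimately show ?thesis
          using step.hyps(1) chain_trans chain_refl by metis
      next
        case False
        then have "(y, z) \<in> chain E r A" "(y, z) \<in> chain E r (A \<union> B)"
          using step by (auto intro!: chain_step)
        then show ?thesis using step chain_trans by metis
      qed
    qed simp
    done
  then show "(x, y) \<in> near E (2 * (DB + r + DA))"
  proof (elim disjE bexE conjE)
    assume "(x, y) \<in> chain E r A"
    from near_mono[OF _ bounded_chainsD[OF A this]] show ?thesis by simp
  next
    fix b assume b: "b \<in> B" "(x, b) \<in> chain E r (A \<union> B)" "(b, y) \<in> chain E r (A \<union> B)"
    have "(x, b) \<in> near E (DB + r + DA)"
      using near_B[of b x] b sym_chain[OF assms(1), of r "A \<union> B"] near_sym[OF assms(1)] by (metis symD)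
    with near_B[OF b(3,1)] show ?thesis
      by (metis mult_2 near_trans)
  qed
qed

text \<open>Each stop has a point of \<open>X\<close> within \<open>s\<close>, and consecutive such
  points are at most \<open>2 * s + r\<close> apart. There are at most \<open>w * w\<close> pairs of
  points of \<open>X\<close>, so that many of these steps suffice.\<close>

lemma bounded_chains_nbhd:
  assumes "sym E" "finite X" "card X \<le> w" "S \<subseteq> nbhd E s X"
  shows "bounded_chains E r S (w * w * (2 * s + r) + 2 * s)"
proof (rule bounded_chainsI)
  let ?F = "near E (2 * s + r) \<inter> X \<times> X"
  fix x y assume "x \<in> S" "(x, y) \<in> chain E r S"
  from this(1) obtain a where a: "a \<in> X" "(x, a) \<in> near E s"
    using assms(4) by (auto simp: nbhd_def)
  from \<open>(x, y) \<in> chain E r S\<close> have "\<exists>b\<in>X. (y, b) \<in> near E s \<and> (a, b) \<in> ?F\<^sup>*"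
  proof (induction rule: chain_induct)
    case (step y z)
    then obtain b where b: "b \<in> X" "(y, b) \<in> near E s" "(a, b) \<in> ?F\<^sup>*" by blast
    from step obtain c where c: "c \<in> X" "(z, c) \<in> near E s"
      using assms(4) by (auto simp: nbhd_def)
    have "(b, z) \<in> near E (s + r)"
      using near_trans[OF near_sym[OF assms(1) b(2)] step.hyps(2)] .
    then have "(b, c) \<in> near E (2 * s + r)"
      using c(2) by (rule near_trans_le) auto
    then have "(b, c) \<in> ?F" using b c by auto
    with b c show ?case by (meson rtrancl.rtrancl_into_rtrancl)
  qed (use a in auto)
  then obtain b where b: "b \<in> X" "(y, b) \<in> near E s" "(a, b) \<in> ?F\<^sup>*" by blast
  have "finite ?F" using assms(2) by auto
  then obtain n where n: "n \<le> card ?F" "(a, b) \<in> ?F ^^ n"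
    using b(3) by (auto simp: rtrancl_finite_eq_relpow)
  have "card ?F \<le> card (X \<times> X)"
    using assms(2) by (intro card_mono) auto
  also have "\<dots> \<le> w * w"
    using assms(3) by (simp add: card_cartesian_product mult_le_mono)
  finally have "n \<le> w * w" using n(1) by simp
  have "(a, b) \<in> near ?F n"
    using n(2) unfolding near_def by (induction n arbitrary: b) auto
  then have "(a, b) \<in> near E (n * (2 * s + r))"
    by (rule near_subset_power[rotated]) auto
  then have "(a, b) \<in> near E (w * w * (2 * s + r))"
    using \<open>n \<le> w * w\<close> near_mono mult_le_mono1 by metis
  with a(2) have "(x, b) \<in> near E (s + w * w * (2 * s + r))"
    by (rule near_trans)
  moreover have "(b, y) \<in> near E s"
    using b(2) near_sym[OF assms(1)] by metis
  ultimately show "(x, y) \<in> near E (w * w * (2 * s + r) + 2 * s)"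
    by (rule near_trans_le) auto
qed

text \<open>Moving all stops by at most \<open>s\<close> lengthens each step by at most
  \<open>2 * s\<close>; undoing the move at the two endpoints costs another
  \<open>2 * s\<close>.\<close>

lemma bounded_chains_rep:
  assumes "sym E" and rep: "\<And>x. x \<in> S \<Longrightarrow> f x \<in> T \<and> (x, f x) \<in> near E s"
    and T: "bounded_chains E (r + 2 * s) T D"
  shows "bounded_chains E r S (D + 2 * s)"
proof (rule bounded_chainsI)
  have close: "(f x, f y) \<in> chain E (r + 2 * s) T" if "x \<in> S" "y \<in> S" "(x, y) \<in> near E r" for x y
  proof -
    have "(f x, y) \<in> near E (s + r)"
      using that rep near_sym[OF assms(1)] near_trans by metis
    then have "(f x, f y) \<in> near E (r + 2 * s)"
      using rep[OF that(2)] near_trans_le[of "f x" y E "s + r" "f y" s] by auto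
    then show ?thesis using rep that by (intro chain_step) auto
  qed
  fix x y assume xy: "x \<in> S" "y \<in> S" "(x, y) \<in> chain E r S"
  from xy(3) have "(f x, f y) \<in> chain E (r + 2 * s) T"
  proof (induction rule: chain_induct)
    case (step y z)
    then show ?case using close[of y z] chain_trans by fast
  qed simp
  then have "(f x, f y) \<in> near E D"
    using T bounded_chainsD by metis
  then have "(x, f y) \<in> near E (s + D)"
    using rep[OF xy(1)] near_trans by metis
  moreover have "(f y, y) \<in> near E s"
    using rep[OF xy(2)] near_sym[OF assms(1)] by metis
  ultimately show "(x, y) \<in> near E (D + 2 * s)"
    by (rule near_trans_le) auto
qed


section \<open>Elimination orders and their regions\<close>

text \<open>
  Treewidth at most \<open>w\<close>, as a perfect elimination order of a chordal completion: \<open>P v\<close> consists of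
  the neighbours of \<open>v\<close> that come before \<open>v\<close>. The decomposition tree has node set \<open>V\<close>, bags
  \<open>insert v (P v)\<close>, and the last element of \<open>P v\<close> as the parent of \<open>v\<close>.
\<close>

locale elimination =
  fixes V :: "'a set" and E :: "'a rel" and P :: "'a \<Rightarrow> 'a set" and num :: "'a \<Rightarrow> nat" and w :: nat
  assumes sym_E: "sym E"
    and E_subset: "E \<subseteq> V \<times> V"
    and P_subset: "v \<in> V \<Longrightarrow> P v \<subseteq> V"
    and finite_P: "v \<in> V \<Longrightarrow> finite (P v)"
    and card_P: "v \<in> V \<Longrightarrow> card (P v) \<le> w"
    and num_P: "v \<in> V \<Longrightarrow> x \<in> P v \<Longrightarrow> num x < num v"
    and clique_P: "v \<in> V \<Longrightarrow> x \<in> P v \<Longrightarrow> y \<in> P v \<Longrightarrow> x = y \<or> x \<in> P y \<or> y \<in> P x"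
    and E_P: "(x, y) \<in> E \<Longrightarrow> x = y \<or> x \<in> P y \<or> y \<in> P x"
begin

lemma E_in_V: "(x, y) \<in> E \<Longrightarrow> x \<in> V \<and> y \<in> V"
  using E_subset by auto

lemma P_in_V: "v \<in> V \<Longrightarrow> x \<in> P v \<Longrightarrow> x \<in> V"
  using P_subset by auto

section \<open>Ancestors and separators in the decomposition forest\<close>

definition par :: "'a \<Rightarrow> 'a" where
  "par v = (ARG_MAX num x. x \<in> P v)"

lemma par_in_P:
  assumes "v \<in> V" "P v \<noteq> {}"
  shows "par v \<in> P v" and "x \<in> P v \<Longrightarrow> num x \<le> num (par v)"
proof -
  obtain y where "y \<in> P v" using assms by auto
  moreover have "\<forall>y. y \<in> P v \<longrightarrow> num y < num v"
    using num_P assms by auto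
  ultimately have *: "par v \<in> P v \<and> (\<forall>y. y \<in> P v \<longrightarrow> num y \<le> num (par v))"
    unfolding par_def by (intro arg_max_nat_lemma[of "\<lambda>x. x \<in> P v" y num "num v"]) auto
  then show "par v \<in> P v" "x \<in> P v \<Longrightarrow> num x \<le> num (par v)" by auto
qed

text \<open>\<open>P v\<close> is a clique with last element \<open>par v\<close>, so its other
  elements come before \<open>par v\<close> and belong to \<open>P (par v)\<close>.\<close>

lemma P_par:
  assumes "v \<in> V" "x \<in> P v"
  shows "x = par v \<or> x \<in> P (par v)"
proof -
  have ne: "P v \<noteq> {}" using assms by auto
  have "par v \<notin> P x"
    using num_P[of x "par v"] par_in_P(2)[OF assms(1) ne assms(2)] P_in_V[OF assms] by auto
  then show ?thesis
    using clique_P[OF assms(1,2) par_in_P(1)[OF assms(1) ne]] by auto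
qed

lemma par_V: "v \<in> V \<Longrightarrow> P v \<noteq> {} \<Longrightarrow> par v \<in> V"
  using par_in_P P_in_V by blast

lemma num_par: "v \<in> V \<Longrightarrow> P v \<noteq> {} \<Longrightarrow> num (par v) < num v"
  using par_in_P num_P by blast

inductive_set desc :: "'a \<Rightarrow> 'a set" for u where
  self: "u \<in> V \<Longrightarrow> u \<in> desc u"
| down: "v \<in> V \<Longrightarrow> P v \<noteq> {} \<Longrightarrow> par v \<in> desc u \<Longrightarrow> v \<in> desc u"

lemma desc_V: "v \<in> desc u \<Longrightarrow> v \<in> V \<and> u \<in> V"
  by (induction rule: desc.induct) auto

lemma desc_trans: "v \<in> desc u \<Longrightarrow> u \<in> desc t \<Longrightarrow> v \<in> desc t"
  by (induction rule: desc.induct) (auto intro: desc.intros)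

lemma num_desc: "v \<in> desc u \<Longrightarrow> v = u \<or> num u < num v"
proof (induction rule: desc.induct)
  case (down v)
  then show ?case using num_par[of v] by auto
qed auto

lemma desc_antisym: "v \<in> desc u \<Longrightarrow> u \<in> desc v \<Longrightarrow> u = v"
  using num_desc[of v u] num_desc[of u v] by auto

text \<open>By \<open>P_par\<close>, each step up from \<open>v\<close> towards \<open>u\<close>
  keeps \<open>x\<close> in the clique unless \<open>x\<close> is the parent just reached.\<close>

lemma P_desc: "v \<in> desc u \<Longrightarrow> x \<in> P v \<Longrightarrow> x \<in> desc u \<or> x \<in> P u"
proof (induction arbitrary: x rule: desc.induct)
  case (down v)
  then show ?case using P_par[of v x] by auto
qed auto

lemma in_P_desc: "v \<in> V \<Longrightarrow> x \<in> P v \<Longrightarrow> v \<in> desc x"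
proof (induction "num v" arbitrary: v rule: less_induct)
  case less
  have ne: "P v \<noteq> {}" using less.prems by auto
  have "par v \<in> desc x"
    using P_par[OF less.prems] less.hyps[of "par v"] num_par[OF less.prems(1) ne]
      par_V[OF less.prems(1) ne] by (auto intro: desc.self)
  then show ?case using less.prems ne by (auto intro: desc.down)
qed

lemma not_desc_P: "u \<in> V \<Longrightarrow> x \<in> P u \<Longrightarrow> x \<notin> desc u"
  using num_desc num_P by fastforce

text \<open>The clique \<open>P u\<close> separates the subtree below \<open>u\<close> from the
  rest: \<open>x\<close> in \<open>P y\<close> would put \<open>y\<close> below \<open>u\<close>, so
  \<open>y\<close> is in \<open>P x\<close>, and \<open>P_desc\<close> applies.\<close>

lemma edge_exit_desc: "(x, y) \<in> E \<Longrightarrow> x \<in> desc u \<Longrightarrow> y \<notin> desc u \<Longrightarrow> y \<in> P u"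
  using E_P[of x y] P_desc[of x u y] in_P_desc[of y x] E_in_V desc_trans by blast

lemma near_exit_desc:
  assumes "F \<subseteq> E" "(x, y) \<in> near F n" "x \<in> desc u" "y \<notin> desc u"
  obtains z i where "z \<in> P u" "i \<le> n" "(x, z) \<in> near F i" "(z, y) \<in> near F (n - i)"
proof (rule near_exit[of F "desc u" "P u", OF _ assms(2-4)])
  show "b \<in> P u" if "(a, b) \<in> F" "a \<in> desc u" "b \<notin> desc u" for a b
    using edge_exit_desc[of a b u] that assms(1) by auto
qed (use that in auto)

end

locale regions = elimination +
  fixes R :: nat
begin

text \<open>Here \<open>u\<close> is the root of the current region and \<open>v\<close> a candidate
  for the next root. If \<open>P u\<close> is empty the condition holds trivially, so a root of the
  forest is a region by itself.\<close>

definition cut :: "'a \<Rightarrow> 'a \<Rightarrow> bool" where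
  "cut u v \<longleftrightarrow> insert v (P v) \<inter> nbhd E R (P u) = {}"

text \<open>\<open>P (root v)\<close> is the boundary of the region of \<open>v\<close>; it belongs to the parent region.\<close>

function root :: "'a \<Rightarrow> 'a" where
  "root v = (if v \<in> V \<and> P v \<noteq> {} then if cut (root (par v)) v then v else root (par v) else v)"
  by auto
termination
  by (relation "measure num") (auto simp: num_par)

declare root.simps [simp del]

lemma root_desc: "v \<in> V \<Longrightarrow> v \<in> desc (root v)"
proof (induction "num v" arbitrary: v rule: less_induct)
  case less
  then show ?case
    using num_par[of v] par_V[of v] by (subst root.simps) (auto intro: desc.intros)
qed

lemma root_V: "v \<in> V \<Longrightarrow> root v \<in> V"
  using root_desc desc_V by blast

lemma root_root: "root (root v) = root v"
proof (induction "num v" arbitrary: v rule: less_induct)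
  case less
  then show ?case
    using root.simps[of v] num_par[of v] by (cases "root v = v") (auto split: if_splits)
qed

lemma root_eqD:
  assumes "v \<in> V" "root v \<noteq> v"
  shows "P v \<noteq> {}" "root (par v) = root v" "insert v (P v) \<inter> nbhd E R (P (root v)) \<noteq> {}"
  using assms root.simps[of v] by (auto simp: cut_def split: if_splits)

lemma P_root: "v \<in> V \<Longrightarrow> x \<in> P v \<Longrightarrow> root x = root v \<or> x \<in> P (root v)"
proof (induction "num v" arbitrary: v rule: less_induct)
  case less
  show ?case
  proof (cases "root v = v")
    case False
    note rt = root_eqD[OF less.prems(1) False]
    show ?thesis
      using P_par[OF less.prems] less.hyps[OF num_par par_V] rt(2) less.prems(1) rt(1) by auto
  qed (use less in auto)
qed

abbreviation parent_root :: "'a \<Rightarrow> 'a" where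
  "parent_root u \<equiv> root (par u)"

text \<open>As \<open>P u\<close> is nonempty, a region starts at \<open>u\<close> only by a cut,
  which keeps the bag of \<open>u\<close> out of the \<open>R\<close>-neighbourhood of the boundary
  of the parent region. In particular \<open>x\<close> is not on that boundary, so
  \<open>P_root\<close> puts it into the parent region.\<close>

lemma root_boundary:
  assumes "u \<in> V" "root u = u" "x \<in> P u"
  shows "root x = parent_root u" "x \<notin> nbhd E R (P (parent_root u))"
proof -
  have ne: "P u \<noteq> {}" using assms by auto
  have "cut (parent_root u) u"
    using assms root.simps[of u] num_par[OF assms(1) ne] root_desc[OF par_V[OF assms(1) ne]]
      num_desc[of "par u" "parent_root u"] by (auto split: if_splits)
  then show *: "x \<notin> nbhd E R (P (parent_root u))"
    using assms by (auto simp: cut_def)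
  show "root x = parent_root u"
    using P_par[OF assms(1,3)] P_root[of "par u" x] par_V[OF assms(1) ne] *
      subset_nbhd[of x _ E R] by auto
qed

lemma root_in_desc:
  "v \<in> desc b \<Longrightarrow> root b = b \<Longrightarrow> root v \<in> desc b"
proof (induction rule: desc.induct)
  case self
  then show ?case by (auto intro: desc.self)
next
  case (down v)
  show ?case
  proof (cases "root v = v")
    case False
    then show ?thesis using root_eqD[of v] down by auto
  qed (use down in \<open>auto intro: desc.down\<close>)
qed

lemma parent_root_in_desc:
  assumes "a \<in> desc b" "a \<noteq> b" "root b = b"
  shows "parent_root a \<in> desc b"
  using assms by (cases rule: desc.cases) (auto intro: root_in_desc)

text \<open>\<open>b\<close> is the root of the first region entered on the way down from
  \<open>h\<close> to \<open>v\<close>.\<close>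

lemma child_root_exists:
  "v \<in> desc h \<Longrightarrow> root h = h \<Longrightarrow> root v \<noteq> h \<Longrightarrow>
    \<exists>b. root b = b \<and> v \<in> desc b \<and> P b \<noteq> {} \<and> parent_root b = h"
proof (induction rule: desc.induct)
  case (down v)
  show ?case
  proof (cases "root (par v) = h")
    case True
    then have "root v = v" using root_eqD[of v] down by auto
    with True down show ?thesis by (auto intro: desc.self)
  next
    case False
    with down show ?thesis by (auto intro: desc.down)
  qed
qed auto

section \<open>Short walks between regions\<close>

text \<open>The walk leaves the subtree at some \<open>z\<close> in \<open>P a\<close>. To leave the
  subtree of the parent region as well, it would need a vertex of that boundary within
  \<open>R\<close> of \<open>z\<close>, against \<open>root_boundary\<close>.\<close>

lemma near_leave_root:
  assumes "r \<le> R" "(x, y) \<in> near E r" "a \<in> V" "root a = a" "x \<in> desc a" "y \<notin> desc a"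
  shows "P a \<noteq> {}" "x \<in> nbhd E r (P a)" "y \<in> desc (parent_root a)"
proof -
  obtain z i where z: "z \<in> P a" "i \<le> r" "(x, z) \<in> near E i" "(z, y) \<in> near E (r - i)"
    using near_exit_desc[OF order_refl assms(2,5,6)] .
  then show ne: "P a \<noteq> {}" and "x \<in> nbhd E r (P a)"
    using near_mono[OF z(2,3)] by (auto simp: nbhd_def)
  note bd = root_boundary[OF assms(3,4) z(1)]
  let ?c = "parent_root a"
  have "z \<in> desc ?c"
    using bd(1) root_desc[OF P_in_V[OF assms(3) z(1)]] by auto
  show "y \<in> desc ?c"
  proof (rule ccontr)
    assume "y \<notin> desc ?c"
    then obtain z' i' where z': "z' \<in> P ?c" "i' \<le> r - i" "(z, z') \<in> near E i'"
      using near_exit_desc[OF order_refl z(4) \<open>z \<in> desc ?c\<close>] by metis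
    then have "(z, z') \<in> near E R"
      using near_mono[OF _ z'(3), of R] z'(2) assms(1) by simp
    with z'(1) bd(2) show False by (auto simp: nbhd_def)
  qed
qed

text \<open>A path can leave a subtree of regions only through its boundary, and boundaries of nested
  subtrees are more than \<open>R\<close> apart.\<close>

lemma near_regions:
  assumes "r \<le> R" "(x, y) \<in> near E r" "x \<in> V" "y \<in> V" "root x \<noteq> root y"
  obtains
    (siblings) "parent_root (root x) = parent_root (root y)"
      "x \<in> nbhd E r (P (root x))" "y \<in> nbhd E r (P (root y))"
  | (left_child) "parent_root (root x) = root y" "x \<in> nbhd E r (P (root x))"
  | (right_child) "parent_root (root y) = root x" "y \<in> nbhd E r (P (root y))"
proof -
  note sy = near_sym[OF sym_E assms(2)]
  have child: "parent_root (root x) = root y \<and> x \<in> nbhd E r (P (root x))"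
    if x: "x \<in> desc (root y)" and "x \<in> V" "y \<in> V" "root x \<noteq> root y" "(x, y) \<in> near E r" for x y
  proof -
    have ab: "root x \<in> desc (root y)"
      using x root_in_desc root_root by blast
    have y: "y \<notin> desc (root x)"
    proof
      assume "y \<in> desc (root x)"
      then have "root y \<in> desc (root x)" using root_in_desc root_root by blast
      with ab desc_antisym that show False by metis
    qed
    note * = near_leave_root[OF assms(1) that(5) root_V[OF that(2)] root_root root_desc[OF that(2)] y]
    have "root y \<in> desc (parent_root (root x))"
      using *(3) root_in_desc root_root by blast
    moreover have "parent_root (root x) \<in> desc (root y)"
      using parent_root_in_desc[OF ab that(4) root_root] .
    ultimately show ?thesis using * desc_antisym by blast
  qed
  \<comment> \<open>For incomparable regions this gives one inclusion; exchanging \<open>x\<close>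
    and \<open>y\<close> gives the other, so the parent roots agree.\<close>
  have sib: "parent_root (root y) \<in> desc (parent_root (root x)) \<and> x \<in> nbhd E r (P (root x))"
    if x: "x \<notin> desc (root y)" "y \<notin> desc (root x)" "x \<in> V" "y \<in> V" "(x, y) \<in> near E r" for x y
  proof -
    note * = near_leave_root[OF assms(1) that(5) root_V[OF that(3)] root_root root_desc[OF that(3)] x(2)]
    have b: "root y \<in> desc (parent_root (root x))"
      using *(3) root_in_desc root_root by blast
    have "root y \<noteq> parent_root (root x)"
    proof
      assume eq: "root y = parent_root (root x)"
      have "root x \<in> desc (root y)"
        unfolding eq using *(1) root_V[OF that(3)] par_V root_desc by (auto intro: desc.down)
      then show False using x root_desc[OF that(3)] desc_trans by blast
    qed
    then show ?thesis
      using parent_root_in_desc[OF b] root_root *(2) by blast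
  qed
  consider "x \<in> desc (root y)" | "y \<in> desc (root x)" | "x \<notin> desc (root y)" "y \<notin> desc (root x)"
    by blast
  then show thesis
  proof cases
    case 1
    then show ?thesis using child[OF 1 assms(3-5,2)] left_child by auto
  next
    case 2
    then show ?thesis using child[OF 2 assms(4,3) _ sy] assms(5) right_child by auto
  next
    case 3
    then show ?thesis
      using sib[OF 3 assms(3,4,2)] sib[OF 3(2,1) assms(4,3) sy] desc_antisym siblings by metis
  qed
qed

text \<open>Within a region, every clique \<open>P v\<close> loses an element when the neighbourhood of the boundary
  is removed.\<close>

definition outer :: "'a set" where
  "outer = {v \<in> V. v \<notin> nbhd E R (P (root v))}"

text \<open>Pairs from a common bag are allowed even if not in \<open>E\<close>, to replace walks
  through child regions. Bounding their distance in \<open>E\<close> by \<open>M\<close> lets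
  distances be carried back at the cost of a factor \<open>M\<close>.\<close>

definition outer_edges :: "nat \<Rightarrow> 'a rel" where
  "outer_edges M = {(x, y). x \<in> outer \<and> y \<in> outer \<and> root x = root y \<and> (x \<in> P y \<or> y \<in> P x)
     \<and> (x, y) \<in> near E M}"

definition outer_P :: "'a \<Rightarrow> 'a set" where
  "outer_P v = {x \<in> P v. x \<in> outer \<and> root x = root v}"

lemma outer_V: "v \<in> outer \<Longrightarrow> v \<in> V"
  by (auto simp: outer_def)

lemma card_outer_P:
  assumes "v \<in> outer"
  shows "card (outer_P v) \<le> w - 1"
proof -
  have v: "v \<in> V" using assms outer_V by auto
  show ?thesis
  proof (cases "root v = v")
    case True
    have "outer_P v = {}"
      unfolding outer_P_def True
    proof (safe, goal_cases)
      case (1 x)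
      then have "x \<in> desc v" using root_desc[of x] P_in_V[OF v] by auto
      then show ?case using not_desc_P[OF v] 1 by auto
    qed
    then show ?thesis by simp
  next
    case False
    \<comment> \<open>\<open>z\<close> differs from \<open>v\<close> because \<open>v\<close> is
      outer; it is the element that \<open>P v\<close> loses.\<close>
    then obtain z where z: "z \<in> P v" "z \<in> nbhd E R (P (root v))"
      using root_eqD(3)[OF v] assms by (auto simp: outer_def)
    then have "outer_P v \<subseteq> P v - {z}"
      by (auto simp: outer_P_def outer_def)
    then have "card (outer_P v) \<le> card (P v - {z})"
      using finite_P[OF v] by (intro card_mono) auto
    also have "\<dots> \<le> w - 1"
      using card_P[OF v] z(1) finite_P[OF v] by (simp add: card_Diff_singleton)
    finally show ?thesis .
  qed
qed

lemma elimination_outer: "elimination outer (outer_edges M) outer_P num (w - 1)"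
proof
  show "sym (outer_edges M)"
    by (auto simp: outer_edges_def sym_def near_sym[OF sym_E])
  show "finite (outer_P v)" if "v \<in> outer" for v
    using finite_P[OF outer_V[OF that]] by (auto simp: outer_P_def)
  show "x = y \<or> x \<in> outer_P y \<or> y \<in> outer_P x" if "v \<in> outer" "x \<in> outer_P v" "y \<in> outer_P v" for v x y
    using clique_P[OF outer_V[OF that(1)], of x y] that by (auto simp: outer_P_def)
qed (use card_outer_P num_P outer_V in \<open>auto simp: outer_edges_def outer_P_def\<close>)

text \<open>A path that leaves a region without meeting the neighbourhood of its boundary enters and
  leaves some child region through the same clique, so it can be shortcut.\<close>

lemma near_outer_edges:
  assumes "n \<le> M" "root x = h" "root y = h" "x \<in> outer" "y \<in> outer"
    and "(x, y) \<in> near (E - nbhd E R (P h) \<times> UNIV - UNIV \<times> nbhd E R (P h)) n"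
  shows "(x, y) \<in> near (outer_edges M) n"
proof -
  define N where "N = nbhd E R (P h)"
  define F where "F = E - N \<times> UNIV - UNIV \<times> N"
  have FE: "F \<subseteq> E" by (auto simp: F_def)
  have hh: "root h = h" using assms(2) root_root by metis
  have "(x, y) \<in> near F n" using assms(6) by (simp add: F_def N_def)
  \<comment> \<open>Strong induction, since a shortcut consumes several steps at once.\<close>
  then show ?thesis using assms(1,2,4)
  proof (induction n arbitrary: x rule: less_induct)
    case (less n)
    show ?case
    proof (cases n)
      case 0
      then show ?thesis using less by auto
    next
      case (Suc m)
      then obtain z where z: "(x, z) \<in> F\<^sup>=" "(z, y) \<in> near F m"
        using less.prems(1) by (auto simp: near_Suc)
      have xV: "x \<in> V" using less outer_V by auto
      consider "z = x" | "z \<noteq> x" "(x, z) \<in> F" "root z = h" | "z \<noteq> x" "(x, z) \<in> F" "root z \<noteq> h"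
        using z by auto
      then show ?thesis
      proof cases
        case 1
        then have "(x, y) \<in> near (outer_edges M) m"
          using less z Suc by auto
        then show ?thesis using Suc near_mono[of m n] by auto
      next
        case 2
        then have "z \<in> outer" using E_in_V by (auto simp: outer_def F_def N_def)
        have "(x, z) \<in> near E M"
          using 2 FE near_edge[of x z E] near_mono[of "Suc 0" M x z E] less.prems(2) Suc by auto
        then have "(x, z) \<in> outer_edges M"
          using 2 less.prems E_P[of x z] FE \<open>z \<in> outer\<close> by (auto simp: outer_edges_def)
        moreover have "(z, y) \<in> near (outer_edges M) m"
          using less z Suc \<open>z \<in> outer\<close> 2 by auto
        ultimately show ?thesis using Suc by (auto simp: near_Suc)
      next
        case 3
        then have xz: "(x, z) \<in> E" "z \<notin> N" "z \<in> V" using FE E_in_V by (auto simp: F_def)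
        have "z \<notin> P x"
        proof
          assume "z \<in> P x"
          then have "z \<in> P h" using P_root[OF xV] less.prems(3) 3 by auto
          then show False using xz(2) subset_nbhd[of z "P h" E R] by (auto simp: N_def)
        qed
        then have "x \<in> P z" using E_P[OF xz(1)] 3 by auto
        then have "z \<in> desc h"
          using in_P_desc[OF xz(3)] root_desc[OF xV] less.prems(3) desc_trans by auto
        \<comment> \<open>The walk enters the subtree below \<open>b\<close> from \<open>x\<close>
          and leaves it at \<open>q\<close>. Both lie in the clique \<open>P b\<close>, so at most
          one pair of \<open>outer_edges M\<close> replaces \<open>Suc i\<close> steps.\<close>
        then obtain b where b: "root b = b" "z \<in> desc b" "P b \<noteq> {}" "parent_root b = h"
          using child_root_exists[of z h] hh 3 by auto
        then have bV: "b \<in> V" using desc_V by auto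
        have not_desc: "v \<notin> desc b" if "root v = h" for v
        proof
          assume "v \<in> desc b"
          then have "h \<in> desc b" using root_in_desc that b(1) by blast
          moreover have "par b \<in> desc h"
            using root_desc[OF par_V[OF bV b(3)]] b(4) by simp
          ultimately have "par b \<in> desc b" using desc_trans by blast
          then show False using not_desc_P[OF bV par_in_P(1)[OF bV b(3)]] by simp
        qed
        have x: "x \<in> P b"
          using edge_exit_desc[of z x b] sym_E xz(1) b(2) not_desc less.prems(3) by (auto dest: symD)
        obtain q i where q: "q \<in> P b" "i \<le> m" "(z, q) \<in> near F i" "(q, y) \<in> near F (m - i)"
          using near_exit_desc[OF FE z(2) b(2) not_desc[OF assms(3)]] .
        have qo: "q \<in> outer" "root q = h"
          using root_boundary[OF bV b(1) q(1)] b(4) P_in_V[OF bV q(1)] by (auto simp: outer_def)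
        have "(x, q) \<in> near E (Suc i)"
          using near_trans[OF near_edge[OF xz(1)] near_subset[OF FE q(3)]] by simp
        then have "(x, q) \<in> near E M"
          using near_mono[of "Suc i" M] q(2) Suc less.prems(2) by auto
        then have "(x, q) \<in> (outer_edges M)\<^sup>="
          using clique_P[OF bV x q(1)] qo less.prems by (auto simp: outer_edges_def)
        moreover have "(q, y) \<in> near (outer_edges M) (m - i)"
          using less.IH[of "m - i" q] q qo Suc less.prems(2) by auto
        ultimately have "(x, y) \<in> near (outer_edges M) (Suc (m - i))"
          by (auto simp: near_Suc)
        then show ?thesis using near_mono[of "Suc (m - i)" n] Suc by auto
      qed
    qed
  qed
qed

end


section \<open>Two-colouring of graphs of bounded treewidth\<close>

context regions
begin

lemma bounded_chains_nbhd_boundary: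
  assumes "S \<subseteq> nbhd E s (P h)" "h \<in> V \<or> S = {}"
  shows "bounded_chains E r S (w * w * (2 * s + r) + 2 * s)"
proof (cases "h \<in> V")
  case True
  then show ?thesis
    using bounded_chains_nbhd[OF sym_E finite_P card_P assms(1)] by auto
next
  case False
  then show ?thesis using assms(2) by (auto intro: bounded_chainsI)
qed

text \<open>A step of length \<open>M\<close> within a region either avoids the
  \<open>R\<close>-neighbourhood of the boundary, and is then a step for
  \<open>outer_edges M\<close>, or has both ends within \<open>R + M\<close> of the boundary. Chains
  of steps of the first kind are bounded by \<open>D\<close>, hence by \<open>D * M\<close> in
  \<open>E\<close>; all others stay within \<open>s\<close> of the boundary.\<close>

lemma bounded_chains_outer:
  fixes \<gamma> :: "'a \<Rightarrow> bool"
  assumes D: "bounded_chains (outer_edges M) M {v \<in> outer. \<gamma> v = c} D" and s: "s = R + M + D * M"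
  shows "bounded_chains E M {v \<in> outer. \<gamma> v = c \<and> root v = h} (w * w * (2 * s + M) + 2 * s)"
proof -
  let ?F = "outer_edges M" and ?S' = "{v \<in> outer. \<gamma> v = c}"
  let ?S = "{v \<in> outer. \<gamma> v = c \<and> root v = h}"
  \<comment> \<open>The chain components for \<open>outer_edges M\<close> that come within
    \<open>R + M\<close> of the boundary.\<close>
  define T where "T = {v \<in> ?S. \<exists>u\<in>?S. u \<in> nbhd E (R + M) (P h) \<and> (v, u) \<in> chain ?F M ?S'}"
  have F: "sym ?F" "?F \<subseteq> near E M"
    using elimination.sym_E[OF elimination_outer] by (auto simp: outer_edges_def)
  have step: "(x, y) \<in> chain ?F M ?S' \<or> x \<in> T \<and> y \<in> T"
    if xy: "x \<in> ?S" "y \<in> ?S" "(x, y) \<in> near E M" for x y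
  proof -
    from near_avoid[OF xy(3), of "nbhd E R (P h)"] show ?thesis
    proof (elim disjE bexE exE conjE)
      assume "(x, y) \<in> near (E - nbhd E R (P h) \<times> UNIV - UNIV \<times> nbhd E R (P h)) M"
      then have "(x, y) \<in> near ?F M"
        using near_outer_edges[of M M x h y] xy by auto
      then show ?thesis using xy by (auto intro: chain_step)
    next
      fix z i assume z: "z \<in> nbhd E R (P h)" "i \<le> M" "(x, z) \<in> near E i" "(z, y) \<in> near E (M - i)"
      have "x \<in> nbhd E (R + M) (P h)"
        using nbhd_near[OF z(3,1)] z(2) by auto
      moreover have "y \<in> nbhd E (R + M) (P h)"
        using nbhd_near[OF near_sym[OF sym_E z(4)] z(1)] by auto
      ultimately show ?thesis
        using xy by (auto simp: T_def intro!: bexI[of _ x] bexI[of _ y])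
    qed
  qed
  show ?thesis
  proof (rule bounded_chains_fibres[where h = "\<lambda>v. v \<in> T"])
    fix x y assume xy: "x \<in> ?S" "y \<in> ?S" "(x, y) \<in> near E M"
    from step[OF xy] show "(x \<in> T) = (y \<in> T)"
    proof
      assume ch: "(x, y) \<in> chain ?F M ?S'"
      then have "(y, x) \<in> chain ?F M ?S'"
        using sym_chain[OF F(1)] by (meson symD)
      with ch xy show ?thesis
        unfolding T_def by (auto intro: chain_trans)
    qed auto
  next
    fix a
    show "bounded_chains E M {x \<in> ?S. (x \<in> T) = a} (w * w * (2 * s + M) + 2 * s)"
    proof (cases a)
      case True
      have "v \<in> nbhd E s (P h)" if v: "v \<in> T" for v
      proof -
        obtain u where u: "u \<in> nbhd E (R + M) (P h)" "(v, u) \<in> chain ?F M ?S'"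
          using v by (auto simp: T_def)
        have "(v, u) \<in> near E (D * M)"
          by (rule near_subset_power[OF F(2) bounded_chainsD[OF D u(2)]])
        then show ?thesis using nbhd_near[OF _ u(1)] s by auto
      qed
      moreover have "h \<in> V \<or> T = {}"
        using root_V outer_V by (auto simp: T_def)
      ultimately have "bounded_chains E M T (w * w * (2 * s + M) + 2 * s)"
        by (intro bounded_chains_nbhd_boundary[of _ _ h]) auto
      then show ?thesis
        by (rule bounded_chains_mono) (use True in auto)
    next
      case False
      show ?thesis
      proof (rule bounded_chainsI)
        fix x y assume "(x, y) \<in> chain E M {x \<in> ?S. (x \<in> T) = a}"
        then have "(x, y) \<in> chain ?F M ?S'"
        proof (induction rule: chain_induct)
          case (step y z)
          then have "(y, z) \<in> chain ?F M ?S'"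
            using \<open>\<And>y x. x \<in> ?S \<Longrightarrow> y \<in> ?S \<Longrightarrow> (x, y) \<in> near E M \<Longrightarrow> (x, y) \<in> chain ?F M ?S' \<or> x \<in> T \<and> y \<in> T\<close>[of y z]
              False by auto
          with step.IH show ?case by (rule chain_trans)
        qed simp
        from near_subset_power[OF F(2) bounded_chainsD[OF D this]]
        show "(x, y) \<in> near E (w * w * (2 * s + M) + 2 * s)"
          by (rule near_mono[rotated]) (use s in auto)
      qed
    qed
  qed
qed

end

locale region_colouring = regions +
  fixes r :: nat and \<gamma> :: "'a \<Rightarrow> bool"
  assumes R: "4 * r \<le> R"
begin

definition boundary_nbhd :: "nat \<Rightarrow> 'a set" where
  "boundary_nbhd n = {v. v \<in> nbhd E n (P (root v))}"

text \<open>Within \<open>r\<close> of the boundary of its region, a vertex is represented by a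
  boundary vertex. That vertex is outer in the parent region, so \<open>\<gamma>\<close> is
  meaningful there.\<close>

definition rep :: "'a \<Rightarrow> 'a" where
  "rep v = (if v \<in> boundary_nbhd r then SOME x. x \<in> P (root v) \<and> (v, x) \<in> near E r else v)"

definition colour :: "'a \<Rightarrow> bool" where
  "colour v = (if v \<in> boundary_nbhd (2 * r) - boundary_nbhd r then True
    else if v \<in> boundary_nbhd R - boundary_nbhd (2 * r) then False
    else \<gamma> (rep v))"

text \<open>Regions are separated between the two annuli: what is within \<open>2 * r\<close> of the
  boundary counts towards the parent region.\<close>

definition home :: "'a \<Rightarrow> 'a" where
  "home v = (if v \<in> boundary_nbhd (2 * r) then parent_root (root v) else root v)"

lemma boundary_nbhd_mono: "v \<in> boundary_nbhd m \<Longrightarrow> m \<le> n \<Longrightarrow> v \<in> boundary_nbhd n"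
  using nbhd_mono by (auto simp: boundary_nbhd_def)

lemma boundary_nbhd_near:
  "u \<in> boundary_nbhd n \<Longrightarrow> (v, u) \<in> near E m \<Longrightarrow> root v = root u \<Longrightarrow> m + n \<le> k \<Longrightarrow> v \<in> boundary_nbhd k"
  using nbhd_near by (auto simp: boundary_nbhd_def)

lemma rep:
  assumes "v \<in> boundary_nbhd r"
  shows "rep v \<in> P (root v)" "(v, rep v) \<in> near E r"
proof -
  have "\<exists>x. x \<in> P (root v) \<and> (v, x) \<in> near E r"
    using assms by (auto simp: boundary_nbhd_def nbhd_def)
  from someI_ex[OF this] show "rep v \<in> P (root v)" "(v, rep v) \<in> near E r"
    using assms by (auto simp: rep_def)
qed

lemma rep_outer:
  assumes "v \<in> V" "v \<notin> boundary_nbhd R - boundary_nbhd r"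
  shows "rep v \<in> outer" "root (rep v) = home v" "(v, rep v) \<in> near E r"
proof -
  have "rep v \<in> outer \<and> root (rep v) = home v \<and> (v, rep v) \<in> near E r"
  proof (cases "v \<in> boundary_nbhd r")
    case True
    note bd = root_boundary[OF root_V[OF assms(1)] root_root rep(1)[OF True]]
    show ?thesis
      using bd rep[OF True] P_in_V[OF root_V[OF assms(1)] rep(1)[OF True]]
        boundary_nbhd_mono[OF True, of "2 * r"] True
      by (auto simp: outer_def home_def)
  next
    case False
    then have "v \<notin> boundary_nbhd R" using assms(2) by auto
    moreover from this have "v \<notin> boundary_nbhd (2 * r)"
      using boundary_nbhd_mono[of v "2 * r" R] R by auto
    ultimately show ?thesis
      using False assms(1) by (auto simp: rep_def home_def outer_def boundary_nbhd_def)
  qed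
  then show "rep v \<in> outer" "root (rep v) = home v" "(v, rep v) \<in> near E r" by auto
qed

text \<open>Both annuli are at least \<open>r\<close> wide, so a step across distance
  \<open>2 * r\<close> from the boundary leads from the annulus of one colour into that of the
  other.\<close>

lemma near_crossing:
  assumes "(x, y) \<in> near E r" "root x = root y" "x \<in> boundary_nbhd (2 * r)" "y \<notin> boundary_nbhd (2 * r)"
  shows "colour x \<noteq> colour y"
proof -
  have yx: "(y, x) \<in> near E r" by (rule near_sym[OF sym_E assms(1)])
  have "x \<notin> boundary_nbhd r"
    using boundary_nbhd_near[of x r y r "2 * r"] yx assms(2,4) by auto
  moreover have "y \<in> boundary_nbhd R"
    using boundary_nbhd_near[OF assms(3) yx, of R] assms(2) R by auto
  ultimately show ?thesis
    using assms(3,4) by (auto simp: colour_def)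
qed

text \<open>If \<open>y\<close> were within \<open>2 * r\<close> of its own boundary, some vertex of
  \<open>P (root x)\<close> would be within \<open>4 * r\<close> of that boundary, against
  \<open>root_boundary\<close>.\<close>

lemma near_child:
  assumes "(x, y) \<in> near E r" "x \<in> V" "x \<in> nbhd E r (P (root x))" "parent_root (root x) = root y"
  shows "home x = home y"
proof -
  have "y \<notin> boundary_nbhd (2 * r)"
  proof
    assume y: "y \<in> boundary_nbhd (2 * r)"
    obtain z where z: "z \<in> P (root x)" "(x, z) \<in> near E r"
      using assms(3) by (auto simp: nbhd_def)
    have "(z, y) \<in> near E (r + r)"
      using near_trans[OF near_sym[OF sym_E z(2)] assms(1)] .
    then have "z \<in> nbhd E R (P (root y))"
      using y R nbhd_near[of z y E "r + r" "2 * r" "P (root y)" R] by (auto simp: boundary_nbhd_def)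
    then show False
      using root_boundary(2)[OF root_V[OF assms(2)] root_root z(1)] assms(4) by simp
  qed
  moreover have "x \<in> boundary_nbhd (2 * r)"
    using nbhd_mono[OF _ assms(3)] by (auto simp: boundary_nbhd_def)
  ultimately show ?thesis using assms(4) by (auto simp: home_def)
qed

text \<open>The two monochromatic annuli around the boundary of a region separate both colours.\<close>

lemma home_eq:
  assumes "x \<in> V" "y \<in> V" "(x, y) \<in> near E r" "colour x = colour y"
  shows "home x = home y"
proof (cases "root x = root y")
  case True
  then show ?thesis
    using near_crossing[of x y] near_crossing[of y x] near_sym[OF sym_E assms(3)] assms(3,4)
    by (auto simp: home_def)
next
  case False
  have "r \<le> R" using R by auto
  from this assms(3,1,2) False show ?thesis
  proof (cases rule: near_regions)
    case siblings
    then have "x \<in> boundary_nbhd (2 * r)" "y \<in> boundary_nbhd (2 * r)"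
      by (auto simp: boundary_nbhd_def intro: nbhd_mono[of r "2 * r"])
    with siblings show ?thesis by (auto simp: home_def)
  next
    case left_child
    then show ?thesis using near_child assms by auto
  next
    case right_child
    then show ?thesis using near_child[OF near_sym[OF sym_E assms(3)] assms(2)] by auto
  qed
qed

text \<open>Chains keep their home by \<open>home_eq\<close>. Inside one home, chains in the annuli
  also stay in one region by \<open>near_regions\<close>, and close to its boundary;
  \<open>rep\<close> moves the remaining vertices to outer vertices of the home region. Merging
  requires scale \<open>DA + 2 * r\<close> for the latter, and \<open>rep\<close> adds
  \<open>2 * r\<close>.\<close>

lemma bounded_chains_colour:
  assumes DA: "DA = w * w * (2 * R + r) + 2 * R"
    and outer: "\<And>h. bounded_chains E (DA + 4 * r) {v \<in> outer. \<gamma> v = c \<and> root v = h} D"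
  shows "bounded_chains E r {v \<in> V. colour v = c} (2 * (D + 2 * r + r + DA))"
proof (rule bounded_chains_fibres[where h = home])
  show "home x = home y"
    if "x \<in> {v \<in> V. colour v = c}" "y \<in> {v \<in> V. colour v = c}" "(x, y) \<in> near E r" for x y
    using home_eq that by auto
  fix h
  let ?C = "{v \<in> {v \<in> V. colour v = c}. home v = h}"
  let ?N = "boundary_nbhd R - boundary_nbhd r"
  have "bounded_chains E r (?C \<inter> ?N) DA"
  proof (rule bounded_chains_fibres[where h = root])
    show "root x = root y" if "x \<in> ?C \<inter> ?N" "y \<in> ?C \<inter> ?N" "(x, y) \<in> near E r" for x y
    proof (rule ccontr)
      assume "root x \<noteq> root y"
      have "r \<le> R" using R by auto
      from this that(3) _ _ \<open>root x \<noteq> root y\<close> show False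
        by (cases rule: near_regions) (use that in \<open>auto simp: boundary_nbhd_def\<close>)
    qed
    show "bounded_chains E r {x \<in> ?C \<inter> ?N. root x = a} DA" for a
      unfolding DA by (rule bounded_chains_nbhd_boundary[of _ _ a])
        (auto simp: boundary_nbhd_def dest: root_V)
  qed
  moreover have "bounded_chains E (DA + 2 * r) (?C - ?N) (D + 2 * r)"
  proof (rule bounded_chains_rep[OF sym_E, of _ rep])
    show "bounded_chains E (DA + 2 * r + 2 * r) {v \<in> outer. \<gamma> v = c \<and> root v = h} D"
      using outer by (simp add: algebra_simps)
    fix x assume x: "x \<in> ?C - ?N"
    then have "\<gamma> (rep x) = c"
      using boundary_nbhd_mono[of x r "2 * r"] boundary_nbhd_mono[of x "2 * r" R] R
      by (auto simp: colour_def split: if_splits)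
    then show "rep x \<in> {v \<in> outer. \<gamma> v = c \<and> root v = h} \<and> (x, rep x) \<in> near E r"
      using rep_outer[of x] x by auto
  qed
  ultimately have "bounded_chains E r ((?C \<inter> ?N) \<union> (?C - ?N)) (2 * (D + 2 * r + r + DA))"
    by (rule bounded_chains_union[OF sym_E])
  then show "bounded_chains E r ?C (2 * (D + 2 * r + r + DA))"
    by (rule bounded_chains_mono) auto
qed

end

text \<open>\<open>D\<close> is chosen before the graph, which makes it uniform over a class. The
  scale \<open>r\<close> varies in the induction because the hypothesis is applied at the larger
  scale \<open>M\<close>.\<close>

theorem elimination_two_colouring:
  "\<exists>D. \<forall>(V :: 'a set) E P num. elimination V E P num w \<longrightarrow>
    (\<exists>\<gamma> :: 'a \<Rightarrow> bool. \<forall>c. bounded_chains E r {v \<in> V. \<gamma> v = c} D)"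
proof (induction w arbitrary: r)
  case 0
  show ?case
  proof (intro exI[of _ 0] allI impI exI[of _ "\<lambda>_. True"])
    fix V :: "'a set" and E P num c
    assume "elimination V E P num 0"
    then interpret elimination V E P num 0 .
    have "E \<subseteq> Id"
      using E_P E_in_V card_P finite_P by fastforce
    then have "near E r = Id"
      unfolding near_def by (induction r) auto
    then show "bounded_chains E r {v \<in> V. True = c} 0"
      unfolding bounded_chains_def chain_def by (auto elim!: rtrancl_induct)
  qed
next
  case (Suc w)
  define DA where "DA = Suc w * Suc w * (2 * (4 * r) + r) + 2 * (4 * r)"
  define M where "M = DA + 4 * r"
  obtain DI where DI: "\<And>V :: 'a set. \<And>E P num. elimination V E P num w \<Longrightarrow>
    \<exists>\<gamma> :: 'a \<Rightarrow> bool. \<forall>c. bounded_chains E M {v \<in> V. \<gamma> v = c} DI"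
    using Suc.IH[of M] by metis
  define s where "s = 4 * r + M + DI * M"
  define D where "D = Suc w * Suc w * (2 * s + M) + 2 * s"
  show ?case
  proof (intro exI[of _ "2 * (D + 2 * r + r + DA)"] allI impI)
    fix V :: "'a set" and E P num
    assume "elimination V E P num (Suc w)"
    then interpret elimination V E P num "Suc w" .
    interpret regions V E P num "Suc w" "4 * r" ..
    have "elimination outer (outer_edges M) outer_P num w"
      using elimination_outer[of M] by simp
    from DI[OF this] obtain \<gamma> :: "'a \<Rightarrow> bool" where
      \<gamma>: "\<forall>c. bounded_chains (outer_edges M) M {v \<in> outer. \<gamma> v = c} DI" ..
    interpret region_colouring V E P num "Suc w" "4 * r" r \<gamma>
      by unfold_locales simp
    have "bounded_chains E r {v \<in> V. colour v = c} (2 * (D + 2 * r + r + DA))" for c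
      using bounded_chains_outer[OF \<gamma>[rule_format] s_def] unfolding D_def M_def
      by (intro bounded_chains_colour[OF DA_def]) auto
    then show "\<exists>\<gamma> :: 'a \<Rightarrow> bool. \<forall>c. bounded_chains E r {v \<in> V. \<gamma> v = c} (2 * (D + 2 * r + r + DA))"
      by blast
  qed
qed


section \<open>Three-colouring of layered graphs\<close>

text \<open>The first \<open>r\<close> residues of every period are free, a gap too wide for a
  difference of at most \<open>r\<close>.\<close>

lemma div_eq_of_small_gap:
  fixes a b p r :: nat
  assumes "0 < p" "r \<le> a mod p" "r \<le> b mod p" "a \<le> b + r" "b \<le> a + r"
  shows "a div p = b div p"
proof -
  have False if "a div p < b div p" "r \<le> b mod p" "b \<le> a + r" for a b
  proof -
    have "p * Suc (a div p) \<le> p * (b div p)"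
      using that(1) by (intro mult_le_mono2) simp
    moreover have "a = p * (a div p) + a mod p" "b = p * (b div p) + b mod p"
      by simp_all
    moreover have "a mod p < p" using assms(1) by simp
    ultimately show False using that unfolding mult_Suc_right by linarith
  qed
  then show ?thesis using assms linorder_neqE_nat by metis
qed

locale layered =
  fixes V :: "'a set" and E :: "'a rel" and lay :: "'a \<Rightarrow> nat"
  assumes sym_E: "sym E" and E_subset: "E \<subseteq> V \<times> V"
    and lay_edge: "(x, y) \<in> E \<Longrightarrow> lay x \<le> Suc (lay y)"
begin

lemma lay_near: "(x, y) \<in> near E n \<Longrightarrow> lay x \<le> lay y + n"
proof (induction n arbitrary: x)
  case (Suc n)
  then obtain z where "(x, z) \<in> E\<^sup>=" "(z, y) \<in> near E n"
    by (auto simp: near_Suc)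
  then show ?case using Suc.IH[of z] lay_edge[of x z] by auto
qed simp

lemma near_V: "(x, y) \<in> near E n \<Longrightarrow> y \<in> V \<Longrightarrow> x \<in> V"
proof (induction n arbitrary: x)
  case (Suc n)
  then obtain z where "(x, z) \<in> E\<^sup>=" "(z, y) \<in> near E n"
    by (auto simp: near_Suc)
  then show ?case using Suc E_subset by auto
qed simp

definition band :: "nat \<Rightarrow> nat \<Rightarrow> 'a set" where
  "band i l = {v \<in> V. i \<le> lay v \<and> lay v < i + l}"

text \<open>Walks of length \<open>r\<close> from the band stay in the band padded by
  \<open>r\<close> layers on either side, so a colouring of the padded subgraph serves.\<close>

lemma band_two_colouring:
  assumes D: "\<And>(V :: 'a set) E P num. elimination V E P num w \<Longrightarrow>
      \<exists>\<gamma> :: 'a \<Rightarrow> bool. \<forall>c. bounded_chains E r {v \<in> V. \<gamma> v = c} D"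
    and elim: "\<And>i. \<exists>P num. elimination (band i (l + 2 * r)) (E \<inter> band i (l + 2 * r) \<times> band i (l + 2 * r)) P num w"
  shows "\<exists>\<gamma> :: 'a \<Rightarrow> bool. \<forall>c. bounded_chains E r {v \<in> band i l. \<gamma> v = c} D"
proof -
  \<comment> \<open>For \<open>i < r\<close> the difference is truncated to 0; there are no layers
    below to pad with.\<close>
  define I where "I = band (i - r) (l + 2 * r)"
  define F where "F = E \<inter> I \<times> I"
  obtain P num where "elimination I F P num w"
    using elim[of "i - r"] unfolding I_def F_def by blast
  from D[OF this] obtain \<gamma> :: "'a \<Rightarrow> bool" where \<gamma>: "\<forall>c. bounded_chains F r {v \<in> I. \<gamma> v = c} D" ..
  have F: "E - (- I) \<times> UNIV - UNIV \<times> (- I) = F"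
    by (auto simp: F_def)
  have near_F: "(x, y) \<in> near F r" if xy: "x \<in> band i l" "(x, y) \<in> near E r" for x y
  proof (rule ccontr)
    assume "(x, y) \<notin> near F r"
    then obtain z j where z: "z \<notin> I" "j \<le> r" "(x, z) \<in> near E j"
      using near_avoid[OF xy(2), of "- I"] F by auto
    have zx: "(z, x) \<in> near E j" by (rule near_sym[OF sym_E z(3)])
    have "z \<in> I"
      using lay_near[OF z(3)] lay_near[OF zx] near_V[OF zx] z(2) xy(1)
      by (auto simp: I_def band_def)
    with z(1) show False ..
  qed
  have "bounded_chains E r {v \<in> band i l. \<gamma> v = c} D" for c
  proof (rule bounded_chainsI)
    fix x y assume "(x, y) \<in> chain E r {v \<in> band i l. \<gamma> v = c}"
    then have "(x, y) \<in> chain F r {v \<in> I. \<gamma> v = c}"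
    proof (induction rule: chain_induct)
      case (step y z)
      then have "(y, z) \<in> chain F r {v \<in> I. \<gamma> v = c}"
        by (intro chain_step near_F) (auto simp: band_def I_def)
      with step.IH show ?case by (rule chain_trans)
    qed simp
    from bounded_chainsD[OF \<gamma>[rule_format] this] show "(x, y) \<in> near E D"
      by (rule near_subset[rotated]) (auto simp: F_def)
  qed
  then show ?thesis by blast
qed

text \<open>In each period of \<open>4 * r\<close> layers, a band of \<open>3 * r\<close> layers is coloured at scale \<open>r\<close> and
  the remaining \<open>r\<close> layers at a scale so large that merging is harmless. The third colour cuts
  colour \<open>0\<close> on the first \<open>r\<close> layers and colour \<open>1\<close> on the last \<open>r\<close> layers of the wide bands.\<close>

lemma three_colouring:
  assumes "0 < r"
    and wide: "\<And>k. \<exists>\<gamma> :: 'a \<Rightarrow> bool. \<forall>c. bounded_chains E r {v \<in> band (4 * r * k) (3 * r). \<gamma> v = c} DA"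
    and narrow: "\<And>k. \<exists>\<gamma> :: 'a \<Rightarrow> bool. \<forall>c.
      bounded_chains E (DA + 2 * r) {v \<in> band (4 * r * k + 3 * r) r. \<gamma> v = c} DB"
  shows "\<exists>\<chi> :: 'a \<Rightarrow> nat. (\<forall>v. \<chi> v < 3) \<and>
    (\<forall>i. bounded_chains E r {v \<in> V. \<chi> v = i} (2 * (DB + r + DA)))"
proof -
  have "\<forall>k. \<exists>\<gamma> :: 'a \<Rightarrow> bool. \<forall>c. bounded_chains E r {v \<in> band (4 * r * k) (3 * r). \<gamma> v = c} DA"
    using wide by blast
  from choice[OF this] obtain \<alpha> :: "nat \<Rightarrow> 'a \<Rightarrow> bool" where
    \<alpha>: "\<forall>k c. bounded_chains E r {v \<in> band (4 * r * k) (3 * r). \<alpha> k v = c} DA" ..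
  have "\<forall>k. \<exists>\<gamma> :: 'a \<Rightarrow> bool. \<forall>c. bounded_chains E (DA + 2 * r) {v \<in> band (4 * r * k + 3 * r) r. \<gamma> v = c} DB"
    using narrow by blast
  from choice[OF this] obtain \<beta> :: "nat \<Rightarrow> 'a \<Rightarrow> bool" where
    \<beta>: "\<forall>k c. bounded_chains E (DA + 2 * r) {v \<in> band (4 * r * k + 3 * r) r. \<beta> k v = c} DB" ..
  define k where "k v = lay v div (4 * r)" for v
  define m where "m v = lay v mod (4 * r)" for v
  have lay: "lay v = 4 * r * k v + m v" "m v < 4 * r" for v
    using assms(1) by (simp_all add: k_def m_def)
  define \<chi> :: "'a \<Rightarrow> nat" where "\<chi> v =
    (if m v < r \<and> \<alpha> (k v) v \<or> 2 * r \<le> m v \<and> m v < 3 * r \<and> \<not> \<alpha> (k v) v then 2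
     else if (if m v < 3 * r then \<alpha> (k v) v else \<beta> (k v) v) then 0 else 1)" for v
  define A where "A K c = {v \<in> band (4 * r * K) (3 * r). \<alpha> K v = c}" for K c
  define B where "B K c = {v \<in> band (4 * r * K + 3 * r) r. \<beta> K v = c}" for K c
  have AB: "bounded_chains E r (A K c \<union> B K' c) (2 * (DB + r + DA))" for K K' c
    using bounded_chains_union[OF sym_E \<alpha>[rule_format] \<beta>[rule_format]] unfolding A_def B_def .
  have A: "v \<in> A (k v) c" if "v \<in> V" "m v < 3 * r" "\<alpha> (k v) v = c" for v c
    using that lay[of v] by (auto simp: A_def band_def)
  have B: "v \<in> B (k v) c" if "v \<in> V" "\<not> m v < 3 * r" "\<beta> (k v) v = c" for v c
    using that lay[of v] by (auto simp: B_def band_def)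
  \<comment> \<open>After a shift by \<open>t\<close>, the set leaves the first \<open>r\<close>
    residues modulo \<open>p\<close> free, so no step joins different blocks of length
    \<open>p\<close>.\<close>
  have blocks: "bounded_chains E r S (2 * (DB + r + DA))"
    if p: "0 < p" and S: "S \<subseteq> V" "\<And>v. v \<in> S \<Longrightarrow> r \<le> (lay v + t) mod p"
      and sub: "\<And>Q. \<exists>K K' c. {v \<in> S. (lay v + t) div p = Q} \<subseteq> A K c \<union> B K' c" for p t S
  proof (rule bounded_chains_fibres[where h = "\<lambda>v. (lay v + t) div p"])
    fix x y assume xy: "x \<in> S" "y \<in> S" "(x, y) \<in> near E r"
    show "(lay x + t) div p = (lay y + t) div p"
      using lay_near[OF xy(3)] lay_near[OF near_sym[OF sym_E xy(3)]] S(2) xy(1,2) p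
      by (intro div_eq_of_small_gap[of p r]) auto
  next
    fix Q
    obtain K K' c where "{v \<in> S. (lay v + t) div p = Q} \<subseteq> A K c \<union> B K' c"
      using sub by blast
    then show "bounded_chains E r {v \<in> S. (lay v + t) div p = Q} (2 * (DB + r + DA))"
      by (intro bounded_chains_mono[OF AB]) auto
  qed
  have divmod: "(p * q + t) div p = q" "(p * q + t) mod p = t" if "t < p" for p q t :: nat
    using that by auto
  \<comment> \<open>Colour 0 is missing on the first \<open>r\<close> layers of a period; a block
    consists of the rest of a wide band and the narrow band after it.\<close>
  have 0: "bounded_chains E r {v \<in> V. \<chi> v = 0} (2 * (DB + r + DA))"
  proof (rule blocks[of "4 * r" _ 0])
    show "r \<le> (lay v + 0) mod (4 * r)" if "v \<in> {v \<in> V. \<chi> v = 0}" for v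
      using that by (auto simp: \<chi>_def m_def split: if_splits)
    fix Q
    have "v \<in> A Q True \<union> B Q True"
      if "v \<in> {v \<in> {v \<in> V. \<chi> v = 0}. (lay v + 0) div (4 * r) = Q}" for v
      using that A[of v] B[of v] by (auto simp: \<chi>_def k_def split: if_splits)
    then show "\<exists>K K' c. {v \<in> {v \<in> V. \<chi> v = 0}. (lay v + 0) div (4 * r) = Q} \<subseteq> A K c \<union> B K' c"
      by blast
  qed (use assms(1) in auto)
  \<comment> \<open>Colour 1 is missing on the last \<open>r\<close> layers of a wide band, and the
    shift by \<open>2 * r\<close> makes this gap start a period. A block is a narrow band with the
    first \<open>2 * r\<close> layers of the next wide band.\<close>
  have shift1: "(lay v + 2 * r) div (4 * r) = (if m v < 2 * r then k v else Suc (k v)) \<and>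
      r \<le> (lay v + 2 * r) mod (4 * r)" if "\<chi> v = 1" for v
  proof (cases "m v < 2 * r")
    case True
    then have l: "lay v + 2 * r = 4 * r * k v + (m v + 2 * r)" "m v + 2 * r < 4 * r"
      using lay[of v] by auto
    from True show ?thesis unfolding l(1) divmod[OF l(2)] by simp
  next
    case False
    then have "3 * r \<le> m v" using that by (auto simp: \<chi>_def split: if_splits)
    then have l: "lay v + 2 * r = 4 * r * Suc (k v) + (m v - 2 * r)" "m v - 2 * r < 4 * r"
      using lay[of v] by auto
    from False \<open>3 * r \<le> m v\<close> show ?thesis unfolding l(1) divmod[OF l(2)] by simp
  qed
  have 1: "bounded_chains E r {v \<in> V. \<chi> v = 1} (2 * (DB + r + DA))"
  proof (rule blocks[of "4 * r" _ "2 * r"])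
    show "r \<le> (lay v + 2 * r) mod (4 * r)" if "v \<in> {v \<in> V. \<chi> v = 1}" for v
      using shift1 that by auto
    fix Q
    \<comment> \<open>Truncation at \<open>Q = 0\<close> is harmless: vertices of narrow bands have
      \<open>Q = Suc (k v)\<close>.\<close>
    have "v \<in> A Q False \<union> B (Q - 1) False"
      if "v \<in> {v \<in> {v \<in> V. \<chi> v = 1}. (lay v + 2 * r) div (4 * r) = Q}" for v
      using that shift1[of v] A[of v] B[of v] by (auto simp: \<chi>_def split: if_splits)
    then show "\<exists>K K' c. {v \<in> {v \<in> V. \<chi> v = 1}. (lay v + 2 * r) div (4 * r) = Q} \<subseteq> A K c \<union> B K' c"
      by blast
  qed (use assms(1) in auto)
  \<comment> \<open>Colour 2 lives on the first and the last \<open>r\<close> layers of the wide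
    bands. With period \<open>2 * r\<close> and shift \<open>r\<close>, these are the even and the
    odd blocks.\<close>
  have shift2: "(lay v + r) div (2 * r) = (if m v < r then 2 * k v else 2 * k v + 1) \<and>
      r \<le> (lay v + r) mod (2 * r) \<and> m v < 3 * r \<and> \<alpha> (k v) v = (m v < r)" if "\<chi> v = 2" for v
  proof (cases "m v < r")
    case True
    then have l: "lay v + r = 2 * r * (2 * k v) + (m v + r)" "m v + r < 2 * r"
      using lay[of v] by auto
    from True that show ?thesis
      unfolding l(1) divmod[OF l(2)] by (auto simp: \<chi>_def split: if_splits)
  next
    case False
    then have m: "2 * r \<le> m v" "m v < 3 * r" using that by (auto simp: \<chi>_def split: if_splits)
    then have l: "lay v + r = 2 * r * (2 * k v + 1) + (m v - r)" "m v - r < 2 * r"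
      using lay[of v] by (auto simp: algebra_simps)
    from False m that show ?thesis
      unfolding l(1) divmod[OF l(2)] by (auto simp: \<chi>_def split: if_splits)
  qed
  have 2: "bounded_chains E r {v \<in> V. \<chi> v = 2} (2 * (DB + r + DA))"
  proof (rule blocks[of "2 * r" _ r])
    show "r \<le> (lay v + r) mod (2 * r)" if "v \<in> {v \<in> V. \<chi> v = 2}" for v
      using shift2 that by auto
    fix Q
    have "v \<in> A (Q div 2) (even Q)"
      if "v \<in> {v \<in> {v \<in> V. \<chi> v = 2}. (lay v + r) div (2 * r) = Q}" for v
      using that shift2[of v] A[of v] by (auto split: if_splits)
    then show "\<exists>K K' c. {v \<in> {v \<in> V. \<chi> v = 2}. (lay v + r) div (2 * r) = Q} \<subseteq> A K c \<union> B K' c"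
      by blast
  qed (use assms(1) in auto)
  have \<chi>3: "\<chi> v < 3" for v by (auto simp: \<chi>_def)
  have "bounded_chains E r {v \<in> V. \<chi> v = i} (2 * (DB + r + DA))" for i
  proof -
    consider "i = 0" | "i = 1" | "i = 2" | "i \<ge> 3" by linarith
    then show ?thesis
    proof cases
      case 4
      then have "{v \<in> V. \<chi> v = i} = {}" using \<chi>3 by (auto simp: not_le[symmetric])
      then show ?thesis by (auto intro: bounded_chainsI)
    qed (use 0 1 2 in auto)
  qed
  with \<chi>3 show ?thesis by blast
qed

end


section \<open>From tree decompositions to elimination orders\<close>

text \<open>Acyclicity is expressed by \<open>bridge\<close>: deleting an edge separates its
  ends.\<close>

locale rooted_tree =
  fixes W :: "'t set" and A :: "'t rel" and \<rho> :: 't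
  assumes sym_A: "sym A" and A_subset: "A \<subseteq> W \<times> W"
    and reach: "t \<in> W \<Longrightarrow> (\<rho>, t) \<in> A\<^sup>*"
    and bridge: "(s, t) \<in> A \<Longrightarrow> (s, t) \<notin> (A - {(s, t), (t, s)})\<^sup>*"
begin

definition depth :: "'t \<Rightarrow> nat" where
  "depth t = (LEAST n. (\<rho>, t) \<in> A ^^ n)"

definition up :: "'t \<Rightarrow> 't" where
  "up t = (SOME s. (s, t) \<in> A \<and> depth s < depth t)"

lemma up:
  assumes "t \<in> W" "t \<noteq> \<rho>"
  shows "(up t, t) \<in> A" "depth (up t) < depth t"
proof -
  obtain n where "(\<rho>, t) \<in> A ^^ n"
    using reach[OF assms(1)] rtrancl_imp_relpow by metis
  then have "(\<rho>, t) \<in> A ^^ depth t"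
    unfolding depth_def by (rule LeastI)
  then obtain m s where m: "depth t = Suc m" "(\<rho>, s) \<in> A ^^ m" "(s, t) \<in> A"
    using assms(2) by (cases "depth t") auto
  have "depth s \<le> m"
    using m(2) unfolding depth_def by (rule Least_le)
  with m have "\<exists>s. (s, t) \<in> A \<and> depth s < depth t" by auto
  from someI_ex[OF this] show "(up t, t) \<in> A" "depth (up t) < depth t"
    by (auto simp: up_def)
qed

text \<open>If neither end were the parent of the other, deleting the edge would leave all parent
  edges, which connect both ends to \<open>\<rho>\<close>, against \<open>bridge\<close>.\<close>

lemma edge_up:
  assumes "(s, t) \<in> A"
  shows "t \<noteq> \<rho> \<and> s = up t \<or> s \<noteq> \<rho> \<and> t = up s"
proof (rule ccontr)
  assume contra: "\<not> ?thesis"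
  let ?F = "A - {(s, t), (t, s)}"
  have F: "sym ?F" using sym_A by (auto simp: sym_def)
  have "(x, \<rho>) \<in> ?F\<^sup>*" if "x \<in> W" for x
    using that
  proof (induction "depth x" arbitrary: x rule: less_induct)
    case less
    show ?case
    proof (cases "x = \<rho>")
      case False
      note u = up[OF less.prems False]
      have "(x, up x) \<in> ?F"
        using u sym_A contra False by (auto dest: symD)
      moreover have "(up x, \<rho>) \<in> ?F\<^sup>*"
        using less.hyps[OF u(2)] u(1) A_subset by auto
      ultimately show ?thesis by (rule converse_rtrancl_into_rtrancl)
    qed simp
  qed
  then have "(s, \<rho>) \<in> ?F\<^sup>*" "(\<rho>, t) \<in> ?F\<^sup>*"
    using assms A_subset sym_rtrancl[OF F] by (auto dest: symD)
  then show False
    using bridge[OF assms] by (meson rtrancl_trans)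
qed

definition up_rel :: "'t rel" where
  "up_rel = {(t, up t) | t. t \<in> W \<and> t \<noteq> \<rho>}"

lemma depth_up_rel: "(x, y) \<in> up_rel\<^sup>* \<Longrightarrow> x = y \<or> depth y < depth x"
  by (induction rule: rtrancl_induct) (auto simp: up_rel_def dest: up)

lemma leave_subtree:
  assumes "(x, y) \<in> A" "(x, t) \<in> up_rel\<^sup>*" "(y, t) \<notin> up_rel\<^sup>*"
  shows "x = t \<and> t \<noteq> \<rho> \<and> y = up t"
proof -
  have W: "x \<in> W" "y \<in> W" using assms(1) A_subset by auto
  have "\<not> (y \<noteq> \<rho> \<and> x = up y)"
    using assms(2,3) W by (auto simp: up_rel_def intro: converse_rtrancl_into_rtrancl)
  then have y: "x \<noteq> \<rho>" "y = up x" using edge_up[OF assms(1)] by auto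
  have "x = t"
    using assms(2)
  proof (cases rule: converse_rtranclE)
    case (step z)
    then have "z = y" using y by (auto simp: up_rel_def)
    with step assms(3) show ?thesis by simp
  qed
  with y show ?thesis by auto
qed

section \<open>Connected node sets and their top nodes\<close>

definition subtree :: "'t set \<Rightarrow> bool" where
  "subtree S \<longleftrightarrow> S \<noteq> {} \<and> S \<subseteq> W \<and> (\<forall>x\<in>S. \<forall>y\<in>S. (x, y) \<in> (A \<inter> S \<times> S)\<^sup>*)"

definition top_node :: "'t set \<Rightarrow> 't" where
  "top_node S = (ARG_MIN depth t. t \<in> S)"

lemma top_node:
  assumes "subtree S"
  shows "top_node S \<in> S" and "t \<in> S \<Longrightarrow> depth (top_node S) \<le> depth t"
proof -
  obtain s where "s \<in> S" using assms by (auto simp: subtree_def)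
  then show "top_node S \<in> S" unfolding top_node_def by (rule arg_min_natI)
  show "depth (top_node S) \<le> depth t" if "t \<in> S" using that unfolding top_node_def by (rule arg_min_nat_le)
qed

text \<open>By \<open>leave_subtree\<close>, a walk inside \<open>S\<close> out of the subtree below
  \<open>t\<close> must use the edge from \<open>t\<close> to \<open>up t\<close>.\<close>

lemma subtree_leave:
  assumes "subtree S" "x \<in> S" "y \<in> S" "(x, t) \<in> up_rel\<^sup>*" "(y, t) \<notin> up_rel\<^sup>*"
  shows "t \<in> S" "t \<noteq> \<rho>" "up t \<in> S"
proof -
  have "(x, y) \<in> (A \<inter> S \<times> S)\<^sup>*"
    using assms(1-3) by (auto simp: subtree_def)
  then have "(y, t) \<in> up_rel\<^sup>* \<or> t \<in> S \<and> t \<noteq> \<rho> \<and> up t \<in> S"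
  proof (induction rule: rtrancl_induct)
    case (step y z)
    then show ?case using leave_subtree[of y z t] by auto
  qed (use assms(4) in auto)
  with assms(5) show "t \<in> S" "t \<noteq> \<rho>" "up t \<in> S" by auto
qed

lemma below_top:
  assumes "subtree S" "x \<in> S"
  shows "(x, top_node S) \<in> up_rel\<^sup>*"
proof (rule ccontr)
  assume "(x, top_node S) \<notin> up_rel\<^sup>*"
  from subtree_leave[OF assms(1) top_node(1)[OF assms(1)] assms(2) _ this]
  have "top_node S \<noteq> \<rho>" "up (top_node S) \<in> S" by auto
  moreover have "top_node S \<in> W" using top_node(1)[OF assms(1)] assms(1) by (auto simp: subtree_def)
  ultimately show False
    using up(2)[of "top_node S"] top_node(2)[OF assms(1), of "up (top_node S)"] by auto
qed

text \<open>\<open>x\<close> lies below both top nodes, while \<open>top_node S\<close>, if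
  different, is not below \<open>top_node S'\<close> by depth. So the connection from
  \<open>x\<close> to \<open>top_node S\<close> within \<open>S\<close> passes through
  \<open>top_node S'\<close>.\<close>

lemma top_in_subtree:
  assumes "subtree S" "subtree S'" "x \<in> S" "x \<in> S'" "depth (top_node S) \<le> depth (top_node S')"
  shows "top_node S' \<in> S"
proof (cases "top_node S = top_node S'")
  case True
  then show ?thesis using top_node(1)[OF assms(1)] by simp
next
  case False
  have "(top_node S, top_node S') \<notin> up_rel\<^sup>*"
    using depth_up_rel[of "top_node S" "top_node S'"] assms(5) False by auto
  with subtree_leave(1)[OF assms(1) assms(3) top_node(1)[OF assms(1)] below_top[OF assms(2,4)]]
  show ?thesis by blast
qed

end

section \<open>Trees and tree decompositions of digraphs\<close>

text \<open>A simple path from \<open>s\<close> to \<open>t\<close> avoiding the edge has at least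
  two arcs, and the arc back closes it to a cycle of length at least 3.\<close>

lemma undirected_tree_bridge:
  assumes "undirected_tree T" and st: "(s, t) \<in> arcs_ends T"
  shows "(s, t) \<notin> (arcs_ends T - {(s, t), (t, s)})\<^sup>*"
proof
  assume *: "(s, t) \<in> (arcs_ends T - {(s, t), (t, s)})\<^sup>*"
  interpret graph T using assms by (simp add: undirected_tree_def)
  define H where "H = T\<lparr>arcs := {e \<in> arcs T. arc_to_ends T e \<notin> {(s, t), (t, s)}}\<rparr>"
  interpret H: wf_digraph H by unfold_locales (auto simp: H_def)
  have sub: "subgraph H T"
    using wf_digraph_axioms H.wf_digraph_axioms by (auto simp: H_def compatible_def intro!: subgraphI)
  have ends: "arcs_ends H = arcs_ends T - {(s, t), (t, s)}"
    by (auto simp: H_def arcs_ends_def arc_to_ends_def)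
  have s: "s \<in> verts T" "t \<in> verts T" "s \<noteq> t"
    using st adj_in_verts adj_not_same by auto
  have "s \<rightarrow>\<^sup>*\<^bsub>H\<^esub> t"
    using * s unfolding H.reachable_conv ends by (simp add: H_def)
  then obtain p where p: "H.apath s p t"
    unfolding H.reachable_apath by blast
  then have pT: "apath s p t"
    using subgraph_apath_imp_apath[OF _ sub] by blast
  have "(t, s) \<in> arcs_ends T"
    using st sym_arcs by (auto simp: symmetric_def dest: symD)
  then obtain e where e: "e \<in> arcs T" "tail T e = t" "head T e = s" by auto
  have "cycle (e # p)"
    unfolding cycle_def using pT e by (intro exI[of _ t]) (auto simp: apath_def awalk_Cons_iff)
  moreover have "3 \<le> length (e # p)"
  proof -
    have "p \<noteq> []" using pT s by (auto simp: apath_Nil_iff)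
    moreover have "p \<noteq> [a]" for a
    proof
      assume "p = [a]"
      then have "(s, t) \<in> arcs_ends H"
        using p by (auto simp: H.apath_Cons_iff H.apath_Nil_iff dest: H.in_arcs_imp_in_arcs_ends)
      then show False unfolding ends by simp
    qed
    ultimately show ?thesis
      by (cases p; cases "tl p") auto
  qed
  ultimately show False
    using assms(1) by (auto simp: undirected_tree_def)
qed

lemma connected_rtrancl:
  assumes "sym (arcs_ends G)" "Digraph_Component.connected G" "u \<in> verts G" "v \<in> verts G"
  shows "(u, v) \<in> (arcs_ends G)\<^sup>*"
proof -
  have "(arcs_ends G)\<^sup>s = arcs_ends G"
    using assms(1) by (auto simp: symcl_def dest: symD)
  then have "(u, v) \<in> rtrancl_on (verts G) (arcs_ends G)"
    using assms unfolding connected_conv by metis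
  then show ?thesis by (rule rtrancl_on_rtranclI)
qed

lemma arcs_ends_induce_subgraph: "arcs_ends (induce_subgraph G S) = arcs_ends G \<inter> S \<times> S"
  by (auto simp: arcs_ends_conv)

lemma rooted_tree_undirected_tree:
  assumes "undirected_tree T" "\<rho> \<in> verts T"
  shows "rooted_tree (verts T) (arcs_ends T) \<rho>"
proof -
  interpret graph T using assms by (simp add: undirected_tree_def)
  have "sym (arcs_ends T)" using sym_arcs by (simp add: symmetric_def)
  then show ?thesis
    using assms undirected_tree_bridge[OF assms(1)] adj_in_verts
      connected_rtrancl[of T \<rho>]
    by unfold_locales (auto simp: undirected_tree_def)
qed

text \<open>Vertices are ordered by the depth of the top node whose bag contains them, and
  \<open>P v\<close> consists of the earlier vertices in the top bag of \<open>v\<close>. By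
  \<open>top_in_subtree\<close>, two vertices with a common bag share the top bag of the later one,
  which gives the clique and edge conditions.\<close>

lemma elimination_tree_decomposition:
  fixes G :: "('a, 'b) pre_digraph" and T :: "('t, 'e) pre_digraph"
  assumes G: "finite (verts G)" "sym (arcs_ends G)" "arcs_ends G \<subseteq> verts G \<times> verts G"
    and TB: "tree_decomposition G T B"
  shows "\<exists>P num. elimination (verts G) (arcs_ends G) P num (decomposition_width T B)"
proof -
  have T: "undirected_tree T" and B: "\<And>t. t \<in> verts T \<Longrightarrow> B t \<subseteq> verts G"
    and edge: "\<And>e. e \<in> arcs G \<Longrightarrow> \<exists>t\<in>verts T. tail G e \<in> B t \<and> head G e \<in> B t"
    and conn: "\<And>v. v \<in> verts G \<Longrightarrow> Digraph_Component.connected (induce_subgraph T {t \<in> verts T. v \<in> B t})"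
    using TB by (auto simp: tree_decomposition_def)
  interpret T: graph T using T by (simp add: undirected_tree_def)
  obtain \<rho> where "\<rho> \<in> verts T"
    using T by (auto simp: undirected_tree_def connected_conv)
  then interpret rooted_tree "verts T" "arcs_ends T" \<rho>
    by (rule rooted_tree_undirected_tree[OF T])
  define S where "S v = {t \<in> verts T. v \<in> B t}" for v
  have S: "subtree (S v)" if "v \<in> verts G" for v
  proof -
    have "sym (arcs_ends T \<inter> S v \<times> S v)"
      using sym_A by (auto simp: sym_def)
    then show ?thesis
      using connected_rtrancl[of "induce_subgraph T (S v)"] conn[OF that]
      unfolding subtree_def S_def[symmetric] arcs_ends_induce_subgraph connected_conv
      by (auto simp: S_def)
  qed
  obtain idx :: "'a \<Rightarrow> nat" where idx: "bij_betw idx (verts G) {0..<card (verts G)}"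
    using ex_bij_betw_finite_nat[OF G(1)] by blast
  define N where "N = card (verts G)"
  define d where "d v = depth (top_node (S v))" for v
  \<comment> \<open>Lexicographic: depth first, ties broken by \<open>idx\<close>, which is below
    \<open>N\<close>.\<close>
  define num where "num v = d v * N + idx v" for v
  have idx_less: "idx v < N" if "v \<in> verts G" for v
    using idx that by (auto simp: bij_betw_def N_def)
  have num_d: "d x \<le> d y" if "num x < num y" "x \<in> verts G" "y \<in> verts G" for x y
  proof (rule ccontr)
    assume "\<not> d x \<le> d y"
    then have "Suc (d y) * N \<le> d x * N" by (intro mult_le_mono1) simp
    then show False using that idx_less[of y] by (simp add: num_def)
  qed
  have num_inj: "x = y" if "num x = num y" "x \<in> verts G" "y \<in> verts G" for x y
  proof -
    have mod: "idx x = num x mod N" "idx y = num y mod N"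
      using idx_less[OF that(2)] idx_less[OF that(3)] by (simp_all add: num_def)
    have "idx x = idx y" unfolding mod that(1) ..
    then show ?thesis using idx that by (auto simp: bij_betw_def inj_on_def)
  qed
  define P where "P v = {x \<in> B (top_node (S v)). num x < num v}" for v
  have topS: "top_node (S v) \<in> verts T" "v \<in> B (top_node (S v))" if "v \<in> verts G" for v
    using top_node(1)[OF S[OF that]] by (auto simp: S_def)
  have in_P: "x \<in> P y" if "x \<in> verts G" "y \<in> verts G" "t \<in> verts T" "x \<in> B t" "y \<in> B t" "num x < num y" for x y t
    using top_in_subtree[OF S[OF that(1)] S[OF that(2)], of t] num_d[OF that(6,1,2)] that
    by (auto simp: S_def P_def d_def)
  have PV: "x \<in> verts G" if "x \<in> P v" "v \<in> verts G" for x v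
    using that B[OF topS(1)] by (auto simp: P_def)
  have tri: "x = y \<or> x \<in> P y \<or> y \<in> P x" if "x \<in> verts G" "y \<in> verts G" "t \<in> verts T" "x \<in> B t" "y \<in> B t" for x y t
    using in_P[OF that] in_P[OF that(2,1,3,5,4)] num_inj[OF _ that(1,2)] by (metis linorder_neqE_nat)
  have card_P: "card (P v) \<le> decomposition_width T B" if v: "v \<in> verts G" for v
  proof -
    have fin: "finite (B (top_node (S v)))"
      using finite_subset[OF B[OF topS(1)[OF v]] G(1)] .
    \<comment> \<open>Leaving out \<open>v\<close> itself matches the subtraction of 1 in
      \<open>decomposition_width\<close>.\<close>
    have "P v \<subseteq> B (top_node (S v)) - {v}" by (auto simp: P_def)
    then have "card (P v) \<le> card (B (top_node (S v)) - {v})"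
      using fin by (intro card_mono) auto
    also have "\<dots> = card (B (top_node (S v))) - 1"
      using topS[OF v] fin by (simp add: card_Diff_singleton)
    also have "\<dots> \<le> decomposition_width T B"
      unfolding decomposition_width_def using topS[OF v] by (intro diff_le_mono Max_ge) auto
    finally show ?thesis .
  qed
  have "elimination (verts G) (arcs_ends G) P num (decomposition_width T B)"
  proof
    fix v assume v: "v \<in> verts G"
    show "P v \<subseteq> verts G" using PV v by blast
    then show "finite (P v)" using G(1) finite_subset by blast
    show "card (P v) \<le> decomposition_width T B" by (rule card_P[OF v])
    show "num x < num v" if "x \<in> P v" for x using that by (simp add: P_def)
    show "x = y \<or> x \<in> P y \<or> y \<in> P x" if "x \<in> P v" "y \<in> P v" for x y
      using tri[OF PV[OF that(1) v] PV[OF that(2) v] topS(1)[OF v]] that by (auto simp: P_def)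
  next
    fix x y assume "(x, y) \<in> arcs_ends G"
    then obtain e where "e \<in> arcs G" "tail G e = x" "head G e = y" by auto
    then show "x = y \<or> x \<in> P y \<or> y \<in> P x"
      using edge tri G(3) \<open>(x, y) \<in> arcs_ends G\<close> by blast
  qed (use G in auto)
  then show ?thesis by blast
qed

lemma elimination_mono:
  "elimination V E P num w \<Longrightarrow> w \<le> w' \<Longrightarrow> elimination V E P num w'"
  unfolding elimination_def by (meson order_trans)

lemma elimination_treewidth:
  assumes "finite (verts G)" "sym (arcs_ends G)" "arcs_ends G \<subseteq> verts G \<times> verts G"
    and tw: "treewidth G \<le> enat w"
  shows "\<exists>P num. elimination (verts G) (arcs_ends G) P num w"
proof -
  let ?W = "{enat (decomposition_width T B) | (T :: (nat, nat \<times> nat) pre_digraph) B. tree_decomposition G T B}"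
  \<comment> \<open>Finite treewidth means that some decomposition exists; the infimum is then
    attained by well-ordering.\<close>
  have "?W \<noteq> {}"
  proof
    assume "?W = {}"
    then have "treewidth G = \<infinity>" unfolding treewidth_def by (simp only:) (simp add: top_enat_def)
    with tw show False by simp
  qed
  then have "treewidth G \<in> ?W"
    unfolding treewidth_def using wellorder_InfI by (metis (no_types, lifting) all_not_in_conv)
  then obtain T :: "(nat, nat \<times> nat) pre_digraph" and B where TB: "tree_decomposition G T B"
    and "treewidth G = enat (decomposition_width T B)" by auto
  then have "decomposition_width T B \<le> w" using tw by simp
  then show ?thesis
    using elimination_tree_decomposition[OF assms(1-3) TB] elimination_mono by blast
qed


section \<open>Asymptotic dimension\<close>

lemma graph_dist_le:
  assumes "wf_digraph G" "(x, y) \<in> near (arcs_ends G) n" "x \<in> verts G"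
  shows "graph_dist G x y \<le> ereal (real n)"
proof -
  interpret wf_digraph G by fact
  have "\<exists>p. awalk x p y \<and> awalk_cost (\<lambda>_. 1) p \<le> real n"
    using assms(2,3)
  proof (induction n arbitrary: x)
    case 0
    then show ?case by (intro exI[of _ "[]"]) (auto simp: awalk_Nil_iff)
  next
    case (Suc n)
    then obtain z where z: "(x, z) \<in> (arcs_ends G)\<^sup>=" "(z, y) \<in> near (arcs_ends G) n"
      by (auto simp: near_Suc)
    then have "z \<in> verts G" using Suc.prems adj_in_verts by auto
    with Suc.IH z obtain p where p: "awalk z p y" "awalk_cost (\<lambda>_. 1) p \<le> real n" by blast
    from z(1) show ?case
    proof
      assume "(x, z) \<in> arcs_ends G"
      then obtain e where "e \<in> arcs G" "tail G e = x" "head G e = z" by auto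
      with p show ?thesis by (intro exI[of _ "e # p"]) (auto simp: awalk_Cons_iff)
    next
      assume "(x, z) \<in> Id"
      with p show ?thesis by (intro exI[of _ p]) auto
    qed
  qed
  then obtain p where "awalk x p y" "awalk_cost (\<lambda>_. 1) p \<le> real n" by blast
  then show ?thesis
    unfolding graph_dist_def using min_cost_le_walk_cost[of x p y "\<lambda>_. 1"] by (meson ereal_less_eq(3) order_trans)
qed

text \<open>Strictness yields a walk of cost below \<open>n\<close> without an argument that the
  infimum is attained.\<close>

lemma near_of_graph_dist_less:
  assumes "wf_digraph G" "graph_dist G x y < ereal (real n)"
  shows "(x, y) \<in> near (arcs_ends G) n"
proof -
  interpret wf_digraph G by fact
  have walk: "(x, y) \<in> near (arcs_ends G) (length p) \<and> awalk_cost (\<lambda>_. 1) p = real (length p)"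
    if "awalk x p y" for x p
    using that
  proof (induction p arbitrary: x)
    case (Cons e p)
    then have "(x, head G e) \<in> arcs_ends G"
      by (auto simp: awalk_Cons_iff dest: in_arcs_imp_in_arcs_ends)
    with Cons show ?case by (auto simp: awalk_Cons_iff near_Suc)
  qed (auto simp: awalk_Nil_iff)
  obtain p where p: "awalk x p y" "awalk_cost (\<lambda>_. 1) p < real n"
    using assms(2) unfolding graph_dist_def \<mu>_def by (auto simp: INF_less_iff)
  then show ?thesis
    using walk[OF p(1)] near_mono[of "length p" n] by auto
qed

text \<open>The parts are the components of the colour classes under chains at scale
  \<open>r\<close>. Distinct parts of one colour are at distance at least \<open>r\<close>, which
  exceeds \<open>\<delta>\<close>.\<close>

lemma control_of_colouring:
  assumes "graph G" and \<chi>: "\<And>v. \<chi> v < k" and \<delta>: "0 \<le> \<delta>" "\<delta> < real r"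
    and bd: "\<And>i. bounded_chains (arcs_ends G) r {v \<in> verts G. \<chi> v = i} D"
  shows "\<exists>\<P>. partition_on (verts G) \<P> \<and> k_delta_disjoint G k \<delta> \<P> \<and>
    (\<forall>X\<in>\<P>. weak_diameter G X \<le> ereal (real D))"
proof -
  interpret graph G by fact
  let ?V = "verts G" and ?E = "arcs_ends G"
  have sym: "sym ?E" using sym_arcs by (simp add: symmetric_def)
  define R where "R = {(u, v). u \<in> ?V \<and> v \<in> ?V \<and> \<chi> u = \<chi> v \<and> (u, v) \<in> chain ?E r {w \<in> ?V. \<chi> w = \<chi> u}}"
  have equiv: "equiv ?V R"
    by (intro equivI refl_onI symI transI)
      (auto simp: R_def intro: chain_trans symD[OF sym_chain[OF sym]])
  define C where "C i = {v \<in> ?V. \<chi> v = i} // R" for i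
  have "delta_disjoint G \<delta> (C i)" for i
    unfolding delta_disjoint_def
  proof (intro ballI impI)
    fix X Y assume XY: "X \<in> C i" "Y \<in> C i" "X \<noteq> Y"
    have quot: "X \<in> ?V // R" "Y \<in> ?V // R" using XY by (auto simp: C_def quotient_def)
    have "ereal (real r) \<le> graph_dist G x y" if xy: "x \<in> X" "y \<in> Y" for x y
    proof (rule ccontr)
      assume "\<not> ereal (real r) \<le> graph_dist G x y"
      then have "(x, y) \<in> near ?E r"
        using near_of_graph_dist_less[OF wf_digraph_axioms] by auto
      moreover have "x \<in> ?V \<and> \<chi> x = i" "y \<in> ?V \<and> \<chi> y = i"
        using XY xy by (auto simp: C_def quotient_def R_def)
      ultimately have "(x, y) \<in> R"
        by (auto simp: R_def intro: chain_step)
      then have "X = Y"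
        using quotient_eqI[OF equiv quot xy] by simp
      with XY(3) show False ..
    qed
    then have "ereal (real r) \<le> set_dist G X Y"
      unfolding set_dist_def by (intro INF_greatest) auto
    moreover have "ereal \<delta> < ereal (real r)" using \<delta> by simp
    ultimately show "ereal \<delta> < set_dist G X Y" by (rule order.strict_trans2[rotated])
  qed
  moreover have "?V // R = (\<Union>i<k. C i)"
    using \<chi> by (auto simp: C_def quotient_def)
  ultimately have "k_delta_disjoint G k \<delta> (?V // R)"
    unfolding k_delta_disjoint_def by blast
  moreover have "weak_diameter G X \<le> ereal (real D)" if "X \<in> ?V // R" for X
    unfolding weak_diameter_def
  proof (intro SUP_least)
    fix u v assume "u \<in> X" "v \<in> X"
    then have "(u, v) \<in> R"
      using quotient_eq_iff[OF equiv that that] by auto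
    then show "graph_dist G u v \<le> ereal (real D)"
      using graph_dist_le[OF wf_digraph_axioms bounded_chainsD[OF bd]] by (auto simp: R_def)
  qed
  ultimately show ?thesis
    using partition_on_quotient[OF equiv] by blast
qed

text \<open>The arguments of \<open>f\<close> are widths of padded bands: \<open>3 * r\<close>
  layers padded by \<open>r\<close> on either side, and \<open>r\<close> layers padded by their
  larger scale \<open>DA + 2 * r\<close>.\<close>

lemma layering_three_colouring:
  fixes G :: "('a, 'b) pre_digraph" and D :: "nat \<Rightarrow> nat \<Rightarrow> nat"
  assumes "graph G" and L: "layering G L"
    and tw: "\<And>l i. treewidth (induce_subgraph G (\<Union>j\<in>{i..<i + l}. L j)) \<le> enat (f l)"
    and D: "\<And>w r (V :: 'a set) E P num. elimination V E P num w \<Longrightarrow>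
      \<exists>\<gamma> :: 'a \<Rightarrow> bool. \<forall>c. bounded_chains E r {v \<in> V. \<gamma> v = c} (D w r)"
    and "0 < r" and DA: "DA = D (f (3 * r + 2 * r)) r"
    and DB: "DB = D (f (r + 2 * (DA + 2 * r))) (DA + 2 * r)"
  shows "\<exists>\<chi> :: 'a \<Rightarrow> nat. (\<forall>v. \<chi> v < 3) \<and>
    (\<forall>i. bounded_chains (arcs_ends G) r {v \<in> verts G. \<chi> v = i} (2 * (DB + r + DA)))"
proof -
  interpret graph G by fact
  define lay where "lay v = (THE i. v \<in> L i)" for v
  have disj: "i = j" if "v \<in> L i" "v \<in> L j" for v i j
    using L that by (auto simp: layering_def disjoint_family_on_def)
  have lay_eq: "lay v = i" if "v \<in> L i" for v i
    unfolding lay_def using that disj by blast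
  have "verts G = (\<Union>i. L i)" using L by (simp add: layering_def)
  then have L_iff: "v \<in> L i \<longleftrightarrow> v \<in> verts G \<and> lay v = i" for v i
    using lay_eq by blast
  have sym: "sym (arcs_ends G)" using sym_arcs by (simp add: symmetric_def)
  interpret layered "verts G" "arcs_ends G" lay
  proof
    fix x y assume xy: "(x, y) \<in> arcs_ends G"
    then obtain e where "e \<in> arcs G" "tail G e = x" "head G e = y" by auto
    moreover have "x \<in> L (lay x)" "y \<in> L (lay y)"
      using xy adj_in_verts L_iff by auto
    ultimately show "lay x \<le> Suc (lay y)"
      using L unfolding layering_def by blast
  qed (use sym adj_in_verts in auto)
  have elim: "\<exists>P num. elimination (band i l) (arcs_ends G \<inter> band i l \<times> band i l) P num (f l)" for i l
  proof -
    have band: "band i l = (\<Union>j\<in>{i..<i + l}. L j)"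
      by (auto simp: band_def L_iff)
    have "finite (band i l)"
      by (rule finite_subset[of _ "verts G"]) (auto simp: band_def)
    then show ?thesis
      using elimination_treewidth[of "induce_subgraph G (band i l)" "f l"] tw[of i l] sym
      unfolding band arcs_ends_induce_subgraph by (auto simp: sym_def)
  qed
  show ?thesis
  proof (rule three_colouring[OF \<open>0 < r\<close>])
    show "\<exists>\<gamma> :: 'a \<Rightarrow> bool. \<forall>c. bounded_chains (arcs_ends G) r {v \<in> band (4 * r * k) (3 * r). \<gamma> v = c} DA" for k
      unfolding DA by (rule band_two_colouring[OF D elim])
    show "\<exists>\<gamma> :: 'a \<Rightarrow> bool. \<forall>c. bounded_chains (arcs_ends G) (DA + 2 * r)
        {v \<in> band (4 * r * k + 3 * r) r. \<gamma> v = c} DB" for k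
      unfolding DB by (rule band_two_colouring[OF D elim])
  qed
qed

theorem theorem19:
  fixes \<G> :: "('a, 'b) pre_digraph set"
  assumes "\<And>G. G \<in> \<G> \<Longrightarrow> graph G"
    and "bounded_Baker_treewidth \<G>"
  shows "asymptotic_dimension \<G> \<le> 2"
proof -
  obtain f :: "nat \<Rightarrow> nat" where f: "\<And>G. G \<in> \<G> \<Longrightarrow> \<exists>L. layering G L \<and>
      (\<forall>l i. treewidth (induce_subgraph G (\<Union>j\<in>{i..<i + l}. L j)) \<le> enat (f l))"
    using assms(2) unfolding bounded_Baker_treewidth_def by blast
  \<comment> \<open>The bound depends on \<open>w\<close> and \<open>r\<close> but not on the graph,
    so one control function serves the whole class.\<close>
  define D where "D w r = (SOME D. \<forall>(V :: 'a set) E P num. elimination V E P num w \<longrightarrow>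
    (\<exists>\<gamma> :: 'a \<Rightarrow> bool. \<forall>c. bounded_chains E r {v \<in> V. \<gamma> v = c} D))" for w r
  have D: "\<exists>\<gamma> :: 'a \<Rightarrow> bool. \<forall>c. bounded_chains E r {v \<in> V. \<gamma> v = c} (D w r)"
    if "elimination V E P num w" for w r and V :: "'a set" and E P num
    using someI_ex[OF elimination_two_colouring[of w r, where 'a = 'a]] that
    unfolding D_def[symmetric] by blast
  define DA where "DA r = D (f (3 * r + 2 * r)) r" for r
  define DB where "DB r = D (f (r + 2 * (DA r + 2 * r))) (DA r + 2 * r)" for r
  \<comment> \<open>Adding 1 makes the scale positive and, for nonnegative \<open>\<delta>\<close>,
    strictly larger than \<open>\<delta>\<close>.\<close>
  define scale where "scale \<delta> = nat \<lceil>\<delta>\<rceil> + 1" for \<delta> :: real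
  define F where "F \<delta> = (let r = scale \<delta> in real (2 * (DB r + r + DA r)))" for \<delta>
  have "control_function 2 F G" if G: "G \<in> \<G>" for G
    unfolding control_function_def
  proof (intro conjI allI impI)
    fix \<delta> :: real assume "0 \<le> \<delta>"
    then show "0 \<le> F \<delta>" by (simp add: F_def Let_def)
    obtain L where L: "layering G L"
      "\<And>l i. treewidth (induce_subgraph G (\<Union>j\<in>{i..<i + l}. L j)) \<le> enat (f l)"
      using f[OF G] by blast
    have "0 < scale \<delta>" by (simp add: scale_def)
    note three = layering_three_colouring[where D = D and f = f and L = L and r = "scale \<delta>"
        and DA = "DA (scale \<delta>)" and DB = "DB (scale \<delta>)", OF assms(1)[OF G] L]
    have "\<exists>\<chi> :: 'a \<Rightarrow> nat. (\<forall>v. \<chi> v < 3) \<and>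
        (\<forall>i. bounded_chains (arcs_ends G) (scale \<delta>) {v \<in> verts G. \<chi> v = i}
          (2 * (DB (scale \<delta>) + scale \<delta> + DA (scale \<delta>))))"
      by (rule three) (use D \<open>0 < scale \<delta>\<close> in \<open>auto simp: DA_def DB_def\<close>)
    then obtain \<chi> :: "'a \<Rightarrow> nat" where \<chi>: "\<And>v. \<chi> v < 3"
      "\<And>i. bounded_chains (arcs_ends G) (scale \<delta>) {v \<in> verts G. \<chi> v = i}
        (2 * (DB (scale \<delta>) + scale \<delta> + DA (scale \<delta>)))"
      by blast
    have less: "\<delta> < real (scale \<delta>)"
      using \<open>0 \<le> \<delta>\<close> unfolding scale_def by linarith
    have "(2::nat) + 1 = 3" by simp
    then show "\<exists>\<P>. partition_on (verts G) \<P> \<and> k_delta_disjoint G (2 + 1) \<delta> \<P> \<and>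
        (\<forall>X\<in>\<P>. weak_diameter G X \<le> ereal (F \<delta>))"
      using control_of_colouring[OF assms(1)[OF G] \<chi>(1) \<open>0 \<le> \<delta>\<close> less \<chi>(2)]
      by (simp only: F_def Let_def)
  qed
  then have "enat 2 \<in> {enat d | d. \<exists>f. \<forall>G\<in>\<G>. control_function d f G}" by blast
  then have "asymptotic_dimension \<G> \<le> enat 2"
    unfolding asymptotic_dimension_def by (rule Inf_lower)
  then show ?thesis by (simp add: numeral_eq_enat)
qed

end
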